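(* There exist absolute constants $C>0$ and $b_0$ such that for all integers $a,b$ with $1\le a<b$ and $b\ge b_0$, there are an integer $k\ge 1$ and integers \[1<n_1<n_2<\dots<n_k\le b(\log b)(\log\log b)^3(\log\log\log b)^{C}\] with \[\frac ab = \frac1{n_1}+\frac1{n_2}+\dots+\frac1{n_k}.\]
   Context: $\log$ denotes the natural logarithm. *)

theory Defs
  imports Complex_Main
begin

end

theory Submission
  imports Defs "HOL-Real_Asymp.Real_Asymp" "HOL-Number_Theory.Number_Theory"
begin

text \<open>The idea is to compare \<open>a / b\<close> with a fraction whose denominator \<open>Q\<close> has only small prime
factors, \<open>Q = 2 ^ t * (product of the odd primes up to y)\<close>, where \<open>2 * b \<le> Q\<close> and \<open>y\<close> is of order
\<open>ln b\<close>. Choose \<open>r\<close> congruent to \<open>a * Q\<close> modulo \<open>b\<close> in the interval \<open>[Q / 2, Q)\<close>, which is long enough to meet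
every residue class. With \<open>s = (a * Q - r) / b\<close> one gets
\<open>a / b = s / Q + (1 / b) * (r / Q)\<close>, and \<open>s < Q\<close>. If both \<open>s / Q\<close> and \<open>r / Q\<close> are sums of distinct
unit fractions whose denominators divide \<open>Q\<close>, then so is \<open>a / b\<close>, with denominators of two kinds: divisors
of \<open>Q\<close>, and \<open>b\<close> times divisors of \<open>Q\<close>. The two kinds are disjoint unless \<open>b\<close> divides \<open>Q\<close>, when
\<open>a / b\<close> already has denominator \<open>Q\<close>. For \<open>s / Q\<close> the size of the denominators is
harmless, since \<open>Q\<close> itself is small enough; the representation exists because \<open>Q\<close> is a practical number
(\<open>modulus_practical\<close>). For \<open>r / Q\<close> the denominators must be at most \<open>M\<close>, where \<open>b * M\<close> is the
bound aimed at. The whole difficulty lies there.\<close>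

text \<open>The primes are removed from the denominator of \<open>r / Q\<close> one at a time, from the largest down
(\<open>clear_primes_descending\<close>): at the prime \<open>p\<close> one subtracts unit fractions \<open>1 / (p * d)\<close>, with \<open>d\<close>
composed of smaller primes, chosen so that the numerator becomes divisible by \<open>p\<close>. What remains in the
end is a fraction with denominator \<open>2 ^ t\<close>, which binary expansion represents. Since \<open>r / Q \<ge> 1 / 2\<close>, all
the subtracted fractions together must not exceed \<open>1 / 2\<close>. For \<open>p\<close> up to about \<open>sqrt y\<close> the binary expansion
of a residue does it, with \<open>d\<close> a power of 2. For larger \<open>p\<close> the numbers \<open>d\<close> have to be of
size polylogarithmic in \<open>p\<close>, and their reciprocals must have subset sums covering all residues modulo \<open>p\<close>.\<close>

text \<open>This covering is combinatorial. For a set \<open>A\<close> of residues, the number of elements that a translation by \<open>x\<close> moves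
out of \<open>A\<close> is subadditive in \<open>x\<close>, and on average over \<open>x\<close> it is at least \<open>card A / 2\<close> when
\<open>A\<close> has at most \<open>p / 2\<close> elements. Let \<open>G\<close> be a set of primes up to \<open>L\<close> with product at least \<open>p\<close>. By the
Chinese remainder theorem every residue is a sum of at most \<open>2 * card G * L\<close> terms \<open>1 / (q * n)\<close>, with \<open>q\<close> in \<open>G\<close>
and \<open>n\<close> fixed, so one of these terms moves a proportion \<open>1 / (4 * card G * L)\<close> of \<open>A\<close> out of \<open>A\<close>
(\<open>some_cofactor_shift_escapes\<close>). Hence the set of subset sums grows
geometrically, and about \<open>card G * L * ln p\<close> numbers \<open>q * n\<close> are enough. Here \<open>L\<close> is \<open>ln p\<close> up to
a power of \<open>ln (ln p)\<close>, and an \<open>n\<close> can be used again until half of \<open>G\<close> is exhausted for it, so there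
have to be about \<open>L * ln p\<close> values of \<open>n\<close>. This gives \<open>d = q * n\<close> of size \<open>(ln p) ^ 3\<close> up to powers of
\<open>ln (ln p)\<close>, whence \<open>M = ln b * (ln (ln b)) ^ 3 * (ln (ln (ln b))) ^ 10\<close>.\<close>

section \<open>Elementary estimates for primes\<close>

text \<open>With \<open>L(n, m) = 1 / (m * (n choose m))\<close>, Leibniz's harmonic triangle satisfies
\<open>L(n, m + 1) = L(n - 1, m) - L(n, m)\<close> and starts from \<open>L(n, 1) = 1 / n\<close>; so each of its entries in the first \<open>N\<close>
rows is an integer combination of \<open>1, 1 / 2, \<dots>, 1 / N\<close>, and a common multiple of \<open>1, \<dots>, N\<close> clears it.\<close>

lemma leibniz_triangle_dvd:
  fixes D :: nat
  assumes "\<And>k. 1 \<le> k \<Longrightarrow> k \<le> N \<Longrightarrow> k dvd D"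
    and "1 \<le> m" "m \<le> n" "n \<le> N"
  shows "m * (n choose m) dvd D"
  using assms(2-4)
proof (induction m arbitrary: n rule: nat_induct_at_least)
  case base
  then show ?case using assms(1) by simp
next
  case (Suc m)
  obtain n' where n: "n = Suc n'" "m \<le> n'" using Suc.prems by (cases n) auto
  define B where "B = n' choose m"
  have B: "B > 0" using n by (simp add: B_def)
  obtain u where u: "D = m * (n' choose m) * u"
    using Suc.IH[of n'] Suc.prems n by (auto elim: dvdE)
  obtain v where v: "D = m * (n choose m) * v"
    using Suc.IH[of n] Suc.prems by (auto elim: dvdE)
  have top: "Suc m * (n choose Suc m) = n * B"
    unfolding n(1) B_def by (rule Suc_times_binomial)
  have "(n - m) * (n choose m) = n * B"
    unfolding n(1) B_def using binomial_absorb_comp[of "Suc n'" m] by simp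
  then have "(n - m) * D = m * (n * B) * v"
    using v by (metis mult.assoc mult.left_commute)
  then have "m * ((n - m) * (B * u)) = m * (n * B * v)"
    using u by (simp add: B_def algebra_simps)
  then have "(n - m) * (B * u) = n * B * v" using Suc.hyps by simp
  then have "B * ((n - m) * u) = B * (n * v)" by (simp only: ac_simps)
  then have "(n - m) * u = n * v" using B by simp
  then have "int (n - m) * int u = int n * int v" by (metis of_nat_mult)
  then have "int m * int u = int n * (int u - int v)"
    using n by (simp add: algebra_simps)
  moreover have "int D = int B * (int m * int u)" using u by (simp add: B_def)
  ultimately have "int D = int (n * B) * (int u - int v)" by simp
  then have "int (Suc m * (n choose Suc m)) dvd int D" unfolding top by simp
  then show ?case by (simp only: int_dvd_int_iff)
qed

text \<open>The least common multiple \<open>D\<close> of \<open>1, \<dots>, n\<close> is at most \<open>n\<close> to the power of the number of primes up to \<open>n\<close>,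
because each prime contributes a power of at most \<open>n\<close>. It is at least \<open>2 ^ (n - 1)\<close>, because
\<open>D\<close> bounds every \<open>m * (n choose m)\<close> and these add up to \<open>n * 2 ^ (n - 1)\<close>.\<close>

lemma chebyshev_lower:
  assumes "1 \<le> (n::nat)"
  shows "2 ^ (n - 1) \<le> n ^ card {p. prime p \<and> p \<le> n}"
proof -
  define P where "P = {p. prime p \<and> p \<le> n}"
  have fP: "finite P" by (auto simp: P_def)
  have "\<exists>e. p ^ e \<le> n \<and> n < p ^ (e + 1)" if "p \<in> P" for p
    using ex_power_ivl1[of p n] that assms prime_ge_2_nat by (auto simp: P_def)
  then obtain e where e: "\<And>p. p \<in> P \<Longrightarrow> p ^ e p \<le> n" "\<And>p. p \<in> P \<Longrightarrow> n < p ^ (e p + 1)"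
    by metis
  define D where "D = (\<Prod>p\<in>P. p ^ e p)"
  have dvd: "k dvd D" if k: "1 \<le> k" "k \<le> n" for k
  proof -
    have "k = (\<Prod>p\<in>prime_factors k. p ^ multiplicity p k)"
      using k by (simp add: prod_prime_factors)
    also have "\<dots> dvd D" unfolding D_def
    proof (rule prod_dvd_prod_subset2)
      show "prime_factors k \<subseteq> P"
        using k by (auto simp: P_def prime_factors_dvd dest!: dvd_imp_le)
      fix p assume "p \<in> prime_factors k"
      then have p: "prime p" "p \<in> P"
        using k by (auto simp: P_def prime_factors_dvd dest!: dvd_imp_le)
      have "p ^ multiplicity p k \<le> k"
        using k by (intro dvd_imp_le multiplicity_dvd) auto
      then have "p ^ multiplicity p k < p ^ (e p + 1)" using e(2)[OF p(2)] k by simp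
      then have "multiplicity p k < e p + 1"
        using power_less_imp_less_exp prime_gt_1_nat[OF p(1)] by blast
      then show "p ^ multiplicity p k dvd p ^ e p" by (simp add: le_imp_power_dvd)
    qed (use fP in auto)
    finally show ?thesis .
  qed
  have Dpos: "D > 0" unfolding D_def P_def by (auto intro!: prod_pos prime_gt_0_nat)
  have "m * (n choose m) \<le> D" if "m \<le> n" for m
  proof (cases "m = 0")
    case False
    then show ?thesis using that leibniz_triangle_dvd[of n D m n] dvd Dpos
      by (auto intro: dvd_imp_le)
  qed simp
  then have "(\<Sum>m\<in>{1..n}. m * (n choose m)) \<le> card {1..n} * D"
    by (intro sum_bounded_above[THEN order_trans]) auto
  moreover have "(\<Sum>m\<in>{1..n}. m * (n choose m)) = (\<Sum>m\<le>n. m * (n choose m))"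
    by (rule sum.mono_neutral_left) auto
  ultimately have "n * 2 ^ (n - 1) \<le> n * D" by (simp add: choose_linear_sum)
  then have "2 ^ (n - 1) \<le> D" using assms by simp
  also have "D \<le> (\<Prod>p\<in>P. n)" unfolding D_def by (rule prod_mono) (use e in auto)
  finally show ?thesis by (simp add: P_def)
qed

text \<open>Half of Mertens' first theorem: \<open>p ^ (n div p)\<close> divides \<open>n!\<close> for every prime \<open>p\<close>, and \<open>n! \<le> n ^ n\<close>. The constant 2
comes from \<open>n div p \<ge> n / (2 * p)\<close>.\<close>

lemma sum_ln_prime_over_prime_le:
  assumes "1 \<le> (n::nat)"
  shows "(\<Sum>p | prime p \<and> p \<le> n. ln (real p) / real p) \<le> 2 * ln (real n)"
proof -
  define P where "P = {p. prime p \<and> p \<le> n}"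
  have fP: "finite P" by (auto simp: P_def)
  have one: "p ^ (n div p) dvd fact n" if "p \<in> P" for p
  proof -
    have p: "p > 0" using that prime_gt_0_nat by (auto simp: P_def)
    have "p ^ (n div p) dvd (\<Prod>i\<in>{1..n div p}. p * i)"
      by (simp add: prod.distrib)
    also have "(\<Prod>i\<in>{1..n div p}. p * i) = \<Prod>((*) p ` {1..n div p})"
      using p by (subst prod.reindex) (auto simp: inj_on_def)
    also have "\<dots> dvd \<Prod>{1..n}"
    proof (rule prod_dvd_prod_subset)
      show "(*) p ` {1..n div p} \<subseteq> {1..n}"
        using p by (auto simp: less_eq_div_iff_mult_less_eq mult.commute)
    qed simp
    finally show ?thesis by (simp add: fact_prod)
  qed
  have "(\<Prod>p\<in>R. p ^ (n div p)) dvd fact n" if "R \<subseteq> P" for R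
    using finite_subset[OF that fP] that
  proof (induction R rule: finite_induct)
    case (insert p R)
    have "coprime (p ^ (n div p)) (\<Prod>p\<in>R. p ^ (n div p))"
      using insert by (intro prod_coprime_right coprime_power_left_iff[THEN iffD2]
        coprime_power_right_iff[THEN iffD2] disjI1) (auto simp: P_def intro!: primes_coprime)
    then show ?case using insert one by (auto intro!: divides_mult)
  qed simp
  then have "(\<Prod>p\<in>P. p ^ (n div p)) \<le> fact n" by (auto intro: dvd_imp_le)
  also have "fact n \<le> n ^ n" using fact_le_power[of n, where 'a = nat] by simp
  finally have "real (\<Prod>p\<in>P. p ^ (n div p)) \<le> real (n ^ n)" by (simp only: of_nat_le_iff)
  then have "(\<Prod>p\<in>P. real p ^ (n div p)) \<le> real n ^ n" by simp
  moreover have pos: "real p > 0" if "p \<in> P" for p using that prime_gt_0_nat by (auto simp: P_def)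
  ultimately have "ln (\<Prod>p\<in>P. real p ^ (n div p)) \<le> ln (real n ^ n)"
    using assms by (subst ln_le_cancel_iff) (auto intro!: prod_pos)
  then have le: "(\<Sum>p\<in>P. real (n div p) * ln p) \<le> n * ln n"
    using pos assms fP by (simp add: ln_prod ln_realpow)
  have "(\<Sum>p\<in>P. real n / 2 * (ln p / p)) \<le> (\<Sum>p\<in>P. real (n div p) * ln p)"
  proof (rule sum_mono)
    fix p assume "p \<in> P"
    then have p: "p \<ge> 1" "p \<le> n" using prime_gt_0_nat[of p] by (auto simp: P_def Suc_leI)
    have "n div p \<ge> 1" using p by (simp add: Suc_leI div_greater_zero_iff)
    then have "p * (n div p) \<ge> p" by simp
    moreover have "p * (n div p) + n mod p = n" "n mod p < p" using p by auto
    ultimately have "n \<le> 2 * (p * (n div p))" by linarith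
    then have "real n \<le> real (2 * (p * (n div p)))" by (simp only: of_nat_le_iff)
    then have "real n / 2 / p \<le> real (n div p)" using p by (simp add: field_simps)
    then have "real n / 2 / p * ln p \<le> real (n div p) * ln p"
      using p by (intro mult_right_mono) auto
    then show "real n / 2 * (ln p / p) \<le> real (n div p) * ln p" by simp
  qed
  also note le
  finally have "real n / 2 * (\<Sum>p\<in>P. ln p / p) \<le> n * ln n" by (simp add: sum_distrib_left)
  then have "real n * (\<Sum>p\<in>P. ln p / p) \<le> real n * (2 * ln n)" by (simp add: field_simps)
  then show ?thesis using assms by (simp add: P_def)
qed

text \<open>The point is that the bound does not depend on \<open>z\<close>: in this range \<open>ln p\<close> is determined up to a factor 2, so the
weights \<open>ln p\<close> can be removed from the previous sum. It bounds the
total of the unit fractions spent on the primes between \<open>z\<close> and \<open>z\<^sup>2\<close>.\<close>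

lemma sum_inverse_primes_square_window:
  assumes "2 \<le> (z::nat)"
  shows "(\<Sum>p | prime p \<and> z < p \<and> p \<le> z\<^sup>2. 1 / real p) \<le> 4"
proof -
  have lz: "ln (real z) > 0" using assms by simp
  have "ln (real z) * (\<Sum>p | prime p \<and> z < p \<and> p \<le> z\<^sup>2. 1 / real p)
      \<le> (\<Sum>p | prime p \<and> z < p \<and> p \<le> z\<^sup>2. ln (real p) / real p)"
    unfolding sum_distrib_left using assms by (intro sum_mono) (auto intro!: divide_right_mono)
  also have "\<dots> \<le> (\<Sum>p | prime p \<and> p \<le> z\<^sup>2. ln (real p) / real p)"
    by (intro sum_mono2) (auto dest: prime_gt_0_nat)
  also have "\<dots> \<le> 2 * ln (real (z\<^sup>2))"
    using assms by (intro sum_ln_prime_over_prime_le) auto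
  also have "\<dots> = ln (real z) * 4" using assms by (simp add: ln_realpow)
  finally show ?thesis using lz by simp
qed

section \<open>Translates of sets of residues\<close>

definition escapes :: "int \<Rightarrow> int set \<Rightarrow> int \<Rightarrow> nat" where
  "escapes p A x = card {a \<in> A. (a + x) mod p \<notin> A}"

lemma escapes_cong: "x mod p = y mod p \<Longrightarrow> escapes p A x = escapes p A y"
  unfolding escapes_def by (metis mod_add_right_eq)

lemma escapes_0: "A \<subseteq> {0..<p} \<Longrightarrow> escapes p A 0 = 0"
proof -
  assume "A \<subseteq> {0..<p}"
  then have "{a \<in> A. (a + 0) mod p \<notin> A} = {}" by (auto simp: subset_iff)
  then show ?thesis unfolding escapes_def by (simp only: card.empty)
qed

text \<open>If \<open>a + x + y\<close> is outside \<open>A\<close>, then either \<open>a\<close> leaves \<open>A\<close> under the translation by \<open>x\<close>, or \<open>a + x\<close> is an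
element of \<open>A\<close> that leaves under the translation by \<open>y\<close>.\<close>

lemma escapes_add_le:
  assumes A: "A \<subseteq> {0..<p}"
  shows "escapes p A (x + y) \<le> escapes p A x + escapes p A y"
proof -
  have fA: "finite A" using A finite_subset by blast
  define S where "S = {a \<in> A. (a + x) mod p \<in> A \<and> (a + x + y) mod p \<notin> A}"
  have "inj_on (\<lambda>a. (a + x) mod p) S"
  proof (rule inj_onI)
    fix a b assume ab: "a \<in> S" "b \<in> S" and "(a + x) mod p = (b + x) mod p"
    then have "a mod p = b mod p"
      by (metis mod_diff_left_eq add_diff_cancel_right')
    then show "a = b" using ab A by (auto simp: S_def subset_iff)
  qed
  moreover have "(\<lambda>a. (a + x) mod p) ` S \<subseteq> {b \<in> A. (b + y) mod p \<notin> A}"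
    by (auto simp: S_def mod_add_left_eq)
  ultimately have S: "card S \<le> escapes p A y"
    unfolding escapes_def using fA by (intro card_inj_on_le) auto
  have "{a \<in> A. (a + (x + y)) mod p \<notin> A} \<subseteq> {a \<in> A. (a + x) mod p \<notin> A} \<union> S"
    by (auto simp: S_def add.assoc)
  then have "escapes p A (x + y) \<le> card ({a \<in> A. (a + x) mod p \<notin> A} \<union> S)"
    unfolding escapes_def using fA by (intro card_mono) (auto simp: S_def)
  also have "\<dots> \<le> escapes p A x + card S"
    unfolding escapes_def by (rule card_Un_le)
  finally show ?thesis using S by simp
qed

lemma escapes_mult_le:
  assumes A: "A \<subseteq> {0..<p}"
  shows "escapes p A (int k * x) \<le> k * escapes p A x"
proof (induction k)
  case 0
  then show ?case using escapes_0[OF A] by simp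
next
  case (Suc k)
  have "escapes p A (int (Suc k) * x) \<le> escapes p A x + escapes p A (int k * x)"
    using escapes_add_le[OF A, of x "int k * x"] by (simp add: algebra_simps)
  then show ?case using Suc by simp
qed

lemma escapes_sum_le:
  assumes A: "A \<subseteq> {0..<p}" and "finite I"
  shows "escapes p A (\<Sum>i\<in>I. x i) \<le> (\<Sum>i\<in>I. escapes p A (x i))"
  using assms(2)
proof (induction I rule: finite_induct)
  case empty
  then show ?case using escapes_0[OF A] by simp
next
  case (insert i I)
  then show ?case using escapes_add_le[OF A, of "x i" "sum x I"] by simp
qed

text \<open>Averaging: every \<open>a\<close> in \<open>A\<close> leaves \<open>A\<close> under exactly \<open>p - card A\<close> of the \<open>p\<close> translations.\<close>

lemma exists_shift_with_many_escapes:
  assumes p: "p > 0" and A: "A \<subseteq> {0..<p}" and half: "2 * int (card A) \<le> p"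
  shows "\<exists>x. card A \<le> 2 * escapes p A x"
proof (rule ccontr)
  assume "\<not> ?thesis"
  then have *: "2 * escapes p A x < card A" for x by (simp add: not_le)
  have fA: "finite A" using A finite_subset by blast
  have inner: "(\<Sum>x\<in>{0..<p}. of_bool ((a + x) mod p \<notin> A) :: int) = p - int (card A)"
    if "a \<in> A" for a
  proof -
    have "bij_betw (\<lambda>x. (a + x) mod p) {0..<p} {0..<p}"
    proof (rule bij_betw_byWitness[where f' = "\<lambda>y. (y - a) mod p"])
    qed (use p in \<open>auto simp: mod_simps\<close>)
    then have "(\<Sum>x\<in>{0..<p}. of_bool ((a + x) mod p \<notin> A) :: int)
        = (\<Sum>y\<in>{0..<p}. of_bool (y \<notin> A))"
      by (rule sum.reindex_bij_betw)
    also have "\<dots> = int (card ({0..<p} - A))"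
      by (simp add: sum_of_bool_eq Diff_eq Int_def)
    also have "\<dots> = p - int (card A)"
      using A fA p card_mono[OF _ A] by (simp add: card_Diff_subset of_nat_diff)
    finally show ?thesis .
  qed
  have "(\<Sum>x\<in>{0..<p}. int (escapes p A x)) =
      (\<Sum>x\<in>{0..<p}. \<Sum>a\<in>A. of_bool ((a + x) mod p \<notin> A))"
    unfolding escapes_def using fA by (simp add: sum_of_bool_eq Int_def)
  also have "\<dots> = (\<Sum>a\<in>A. \<Sum>x\<in>{0..<p}. of_bool ((a + x) mod p \<notin> A))" by (rule sum.swap)
  also have "\<dots> = int (card A) * (p - int (card A))" using inner by simp
  finally have total: "(\<Sum>x\<in>{0..<p}. int (escapes p A x)) = int (card A) * (p - int (card A))" .
  have "(\<Sum>x\<in>{0..<p}. 2 * int (escapes p A x)) < (\<Sum>x\<in>{0..<p}. int (card A))"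
  proof (rule sum_strict_mono)
    show "2 * int (escapes p A x) < int (card A)" for x using *[of x] by linarith
  qed (use p in auto)
  then have "2 * (int (card A) * (p - int (card A))) < p * int (card A)"
    using p by (simp add: total flip: sum_distrib_left)
  moreover have "int (card A) * p \<le> int (card A) * (2 * (p - int (card A)))"
    using half by (intro mult_left_mono) auto
  ultimately show False by (simp add: algebra_simps)
qed

text \<open>Partial fractions: dividing by the product of \<open>G\<close>, this writes a fraction as an integer plus fractions
\<open>j q / q\<close>. The digits \<open>j q\<close> are small, which is what makes the sums below short.\<close>

lemma mixed_radix_representation:
  fixes G :: "nat set" and u :: int
  assumes "finite G" "\<And>q. q \<in> G \<Longrightarrow> 0 < q" "pairwise coprime G"
  shows "\<exists>j w. (\<forall>q\<in>G. j q < q) \<and>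
    u = (\<Sum>q\<in>G. int (j q) * int (\<Prod>(G - {q}))) + w * int (\<Prod>G)"
  using assms
proof (induction G arbitrary: u rule: finite_induct)
  case empty
  then show ?case by auto
next
  case (insert q G)
  define P where "P = int (\<Prod>G)"
  have "coprime (\<Prod>G) q"
    using insert by (intro prod_coprime_left) (auto simp: pairwise_insert)
  then have "coprime P (int q)" unfolding P_def by (simp only: coprime_int_iff)
  then obtain y where y: "[P * y = 1] (mod int q)" using cong_solve_coprime_int by blast
  define i where "i = (u * y) mod int q"
  have q: "q > 0" using insert by auto
  have i: "0 \<le> i" "i < int q" using q by (auto simp: i_def)
  have "[P * i = P * (u * y)] (mod int q)" by (auto simp: i_def cong_def mod_simps)
  moreover have "[P * (u * y) = u * 1] (mod int q)"
    using cong_scalar_left[OF y, of u] by (simp add: ac_simps)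
  ultimately have "[u = P * i] (mod int q)" by (metis cong_sym cong_trans mult.right_neutral)
  then obtain u' where u': "u = P * i + int q * u'"
    by (metis cong_iff_lin cong_sym mult.commute)
  obtain j w where j: "\<forall>q\<in>G. j q < q" and
    w: "u' = (\<Sum>q\<in>G. int (j q) * int (\<Prod>(G - {q}))) + w * P"
    using insert.IH[of u'] insert.prems by (auto simp: pairwise_insert P_def)
  define j' where "j' = j(q := nat i)"
  have "(\<Sum>r\<in>G. int (j' r) * int (\<Prod>(insert q G - {r})))
      = int q * (\<Sum>r\<in>G. int (j r) * int (\<Prod>(G - {r})))"
    unfolding sum_distrib_left
  proof (rule sum.cong)
    fix r assume r: "r \<in> G"
    then have "r \<noteq> q" using insert by auto
    then have "insert q G - {r} = insert q (G - {r})" by auto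
    then show "int (j' r) * int (\<Prod>(insert q G - {r}))
        = int q * (int (j r) * int (\<Prod>(G - {r})))"
      using insert \<open>r \<noteq> q\<close> by (simp add: j'_def)
  qed simp
  moreover have "insert q G - {q} = G" using insert by auto
  ultimately have "u = (\<Sum>r\<in>insert q G. int (j' r) * int (\<Prod>(insert q G - {r})))
      + w * int (\<Prod>(insert q G))"
    using insert i by (simp add: u' w P_def j'_def algebra_simps)
  moreover have "\<forall>r\<in>insert q G. j' r < r"
    using j i insert by (auto simp: j'_def)
  ultimately show ?case by blast
qed

text \<open>This is the growth step. Up to the unit \<open>e * \<Prod>G\<close>, the shifts \<open>e * \<Prod>(G - {q})\<close> are the reciprocals
\<open>1 / q\<close> modulo \<open>p\<close>. As \<open>\<Prod>G \<ge> p\<close>, partial fractions express every residue by at most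
\<open>2 * card G * L\<close> of them, in particular a residue \<open>x\<close> under which half of \<open>A\<close> escapes; by subadditivity
one of the terms lets the corresponding proportion escape.\<close>

lemma some_cofactor_shift_escapes:
  fixes p e :: int and G :: "nat set"
  assumes p: "p > 0" and G: "finite G" "G \<noteq> {}" "pairwise coprime G"
    and L: "\<And>q. q \<in> G \<Longrightarrow> 0 < q \<and> q \<le> L"
    and big: "p \<le> int (\<Prod>G)" and e: "coprime e p"
    and A: "A \<subseteq> {0..<p}" and half: "2 * int (card A) \<le> p"
  shows "\<exists>q\<in>G. card A \<le> 4 * card G * L * escapes p A (e * int (\<Prod>(G - {q})))"
proof -
  define P where "P = int (\<Prod>G)"
  define c where "c q = e * int (\<Prod>(G - {q}))" for q
  define g where "g = int (card G)"
  obtain q0 where q0: "q0 \<in> G" and max: "\<And>q. q \<in> G \<Longrightarrow> escapes p A (c q) \<le> escapes p A (c q0)"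
  proof -
    have "Max ((\<lambda>q. escapes p A (c q)) ` G) \<in> (\<lambda>q. escapes p A (c q)) ` G"
      using G by (intro Max_in) auto
    then obtain q0 where "q0 \<in> G" "Max ((\<lambda>q. escapes p A (c q)) ` G) = escapes p A (c q0)" by auto
    moreover have "escapes p A (c q) \<le> Max ((\<lambda>q. escapes p A (c q)) ` G)" if "q \<in> G" for q
      using that G by (intro Max_ge) auto
    ultimately show ?thesis using that by auto
  qed
  define \<mu> where "\<mu> = escapes p A (c q0)"
  have P: "P > 0" using p big by (simp add: P_def)
  have cof: "int (\<Prod>(G - {q})) * int q = P" if "q \<in> G" for q
  proof -
    have "\<Prod>(G - {q}) * q = \<Prod>G" using that G by (simp add: prod.remove[of G q] mult.commute)
    then show ?thesis unfolding P_def by (simp only: flip: of_nat_mult)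
  qed
  obtain x where x: "card A \<le> 2 * escapes p A x"
    using exists_shift_with_many_escapes[OF p A half] by blast
  obtain y where y: "[e * y = 1] (mod p)" using e cong_solve_coprime_int by blast
  \<comment> \<open>Any \<open>p\<close> consecutive integers contain a solution of \<open>e * u = x\<close> modulo \<open>p\<close>; starting at
    \<open>g * P\<close> makes the integer part \<open>w\<close> below nonnegative.\<close>
  define u where "u = g * P + (x * y - g * P) mod p"
  have u: "g * P \<le> u" "u < g * P + p" using p by (auto simp: u_def)
  have "[u = x * y] (mod p)" by (simp add: u_def cong_def mod_simps)
  then have "[e * u = e * (x * y)] (mod p)" by (rule cong_scalar_left)
  moreover have "[e * (x * y) = x * 1] (mod p)"
    using cong_scalar_left[OF y, of x] by (simp add: ac_simps)
  ultimately have eu: "[e * u = x] (mod p)" using cong_trans by fastforce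
  obtain j w where j: "\<And>q. q \<in> G \<Longrightarrow> j q < q" and
    w: "u = (\<Sum>q\<in>G. int (j q) * int (\<Prod>(G - {q}))) + w * P"
    using mixed_radix_representation[of G u] G L unfolding P_def by auto
  have "(\<Sum>q\<in>G. int (j q) * int (\<Prod>(G - {q}))) \<le> (\<Sum>q\<in>G. P)"
  proof (rule sum_mono)
    fix q assume q: "q \<in> G"
    have "int (j q) * int (\<Prod>(G - {q})) \<le> int q * int (\<Prod>(G - {q}))"
      using j[OF q] by (intro mult_right_mono) (auto intro: prod_nonneg)
    then show "int (j q) * int (\<Prod>(G - {q})) \<le> P" using cof[OF q] by (simp add: mult.commute)
  qed
  then have "(\<Sum>q\<in>G. int (j q) * int (\<Prod>(G - {q}))) \<le> g * P" by (simp add: g_def)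
  then have "0 * P \<le> w * P" using u w by simp
  then have w0: "w \<ge> 0" using P by (simp only: mult_le_cancel_right_pos)
  have "0 \<le> (\<Sum>q\<in>G. int (j q) * int (\<Prod>(G - {q})))" by (intro sum_nonneg) (auto intro!: mult_nonneg_nonneg prod_nonneg)
  then have "w * P < (g + 1) * P" using u w big P_def by (simp add: algebra_simps)
  then have wg: "w \<le> g" using P by simp
  have eu_sum: "e * u = (\<Sum>q\<in>G. int (j q) * c q) + int (nat w * q0) * c q0"
  proof -
    have "e * (w * P) = int (nat w * q0) * c q0"
      using cof[OF q0] w0 by (simp add: c_def algebra_simps)
    then show ?thesis unfolding w by (simp add: c_def sum_distrib_left algebra_simps)
  qed
  have "escapes p A x = escapes p A (e * u)"
    using eu by (intro escapes_cong) (simp add: cong_def)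
  also have "\<dots> \<le> escapes p A (\<Sum>q\<in>G. int (j q) * c q) + escapes p A (int (nat w * q0) * c q0)"
    unfolding eu_sum by (rule escapes_add_le[OF A])
  also have "escapes p A (int (nat w * q0) * c q0) \<le> nat w * q0 * \<mu>"
    unfolding \<mu>_def by (rule escapes_mult_le[OF A])
  also have "nat w * q0 * \<mu> \<le> card G * L * \<mu>"
    using wg L[OF q0] by (intro mult_mono) (auto simp: g_def)
  also have "escapes p A (\<Sum>q\<in>G. int (j q) * c q) \<le> (\<Sum>q\<in>G. L * \<mu>)"
  proof (rule order_trans[OF escapes_sum_le[OF A G(1)] sum_mono])
    fix q assume q: "q \<in> G"
    have "escapes p A (int (j q) * c q) \<le> j q * escapes p A (c q)" by (rule escapes_mult_le[OF A])
    also have "\<dots> \<le> L * \<mu>" unfolding \<mu>_def using j[OF q] L[OF q] max[OF q]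
      by (intro mult_mono) auto
    finally show "escapes p A (int (j q) * c q) \<le> L * \<mu>" .
  qed
  finally have "escapes p A x \<le> 2 * card G * L * \<mu>" by simp
  then show ?thesis using x q0 unfolding \<mu>_def c_def by (intro bexI[of _ q0]) auto
qed

section \<open>Subset sums that cover all residues\<close>

text \<open>Adjoining one element at a time. As long as the set of subset sums has at most \<open>p / 2\<close> elements, some unused
element enlarges it by the factor \<open>1 + 1 / \<kappa>\<close>. The supply hypothesis is only asked for when at most half of \<open>I\<close> has
been used, so that it can be verified without control over which elements were used.\<close>

lemma greedy_subset_sums:
  fixes v :: "'i \<Rightarrow> int" and p :: int
  assumes p: "p > 0" and I: "finite I"
    and step: "\<And>U A. U \<subseteq> I \<Longrightarrow> 2 * card U \<le> card I \<Longrightarrow> A \<subseteq> {0..<p} \<Longrightarrow> 2 * int (card A) \<le> p \<Longrightarrow>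
      \<exists>i\<in>I - U. card A \<le> \<kappa> * escapes p A (v i)"
    and T: "2 * T \<le> card I" and growth: "p * int \<kappa> ^ T < (int \<kappa> + 1) ^ T"
  shows "\<exists>U\<subseteq>I. card U \<le> T \<and> p < 2 * int (card ((\<lambda>V. sum v V mod p) ` Pow U))"
proof -
  define R where "R U = (\<lambda>V. sum v V mod p) ` Pow U" for U
  have R: "R U \<subseteq> {0..<p}" for U using p by (auto simp: R_def)
  have "\<exists>U\<subseteq>I. card U \<le> t \<and>
      (p < 2 * int (card (R U)) \<or> (\<kappa> + 1) ^ t \<le> \<kappa> ^ t * card (R U))" if "t \<le> T" for t
    using that
  proof (induction t)
    case 0
    then show ?case by (intro exI[of _ "{}"]) (auto simp: R_def)
  next
    case (Suc t)
    then obtain U where U: "U \<subseteq> I" "card U \<le> t"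
      "p < 2 * int (card (R U)) \<or> (\<kappa> + 1) ^ t \<le> \<kappa> ^ t * card (R U)" by auto
    show ?case
    proof (cases "p < 2 * int (card (R U))")
      case True
      then show ?thesis using U by (intro exI[of _ U]) auto
    next
      case False
      obtain i where i: "i \<in> I" "i \<notin> U" "card (R U) \<le> \<kappa> * escapes p (R U) (v i)"
        using step[of U "R U"] U R[of U] False T Suc.prems by auto
      have fU: "finite U" using U I finite_subset by blast
      define E where "E = {a \<in> R U. (a + v i) mod p \<notin> R U}"
      have fR: "finite (R U)" for U using R[of U] finite_subset by blast
      have inj: "inj_on (\<lambda>a. (a + v i) mod p) E"
      proof (rule inj_onI)
        fix a b assume ab: "a \<in> E" "b \<in> E" and "(a + v i) mod p = (b + v i) mod p"
        then have "a mod p = b mod p" by (metis mod_diff_left_eq add_diff_cancel_right')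
        then show "a = b" using ab R[of U] by (auto simp: E_def subset_iff)
      qed
      have "R U \<union> (\<lambda>a. (a + v i) mod p) ` E \<subseteq> R (insert i U)"
      proof (intro Un_least subsetI)
        fix a assume "a \<in> (\<lambda>a. (a + v i) mod p) ` E"
        then obtain V where V: "V \<subseteq> U" "a = (sum v V mod p + v i) mod p"
          by (auto simp: E_def R_def)
        have "sum v (insert i V) = sum v V + v i"
          using V i fU finite_subset by (subst sum.insert) auto
        then have "a = sum v (insert i V) mod p" using V by (simp add: mod_simps)
        then show "a \<in> R (insert i U)" using V by (auto simp: R_def)
      qed (auto simp: R_def)
      then have "card (R U \<union> (\<lambda>a. (a + v i) mod p) ` E) \<le> card (R (insert i U))"
        using fR by (intro card_mono) auto
      moreover have "card (R U \<union> (\<lambda>a. (a + v i) mod p) ` E) = card (R U) + escapes p (R U) (v i)"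
        using fR inj by (subst card_Un_disjoint) (auto simp: card_image E_def escapes_def)
      ultimately have "\<kappa> * (card (R U) + escapes p (R U) (v i)) \<le> \<kappa> * card (R (insert i U))"
        by (metis mult_le_mono2)
      then have "(\<kappa> + 1) * card (R U) \<le> \<kappa> * card (R (insert i U))" using i by (simp add: algebra_simps)
      then have "\<kappa> ^ t * ((\<kappa> + 1) * card (R U)) \<le> \<kappa> ^ t * (\<kappa> * card (R (insert i U)))"
        by (rule mult_le_mono2)
      moreover have "(\<kappa> + 1) * (\<kappa> + 1) ^ t \<le> (\<kappa> + 1) * (\<kappa> ^ t * card (R U))"
        using U(3) False by (intro mult_le_mono2) auto
      ultimately have "(\<kappa> + 1) ^ Suc t \<le> \<kappa> ^ Suc t * card (R (insert i U))"
        by (simp add: algebra_simps)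
      then show ?thesis using U i fU by (intro exI[of _ "insert i U"]) auto
    qed
  qed
  then obtain U where U: "U \<subseteq> I" "card U \<le> T"
    "p < 2 * int (card (R U)) \<or> (\<kappa> + 1) ^ T \<le> \<kappa> ^ T * card (R U)" by blast
  have "p < 2 * int (card (R U))"
  proof (rule ccontr)
    assume neg: "\<not> ?thesis"
    then have "int ((\<kappa> + 1) ^ T) \<le> int (\<kappa> ^ T * card (R U))" using U(3) neg unfolding of_nat_le_iff by blast
    then have "(int \<kappa> + 1) ^ T \<le> int \<kappa> ^ T * int (card (R U))" by (simp add: add.commute)
    also have "\<dots> \<le> int \<kappa> ^ T * p" using neg p by (intro mult_left_mono) auto
    finally show False using growth by (simp add: mult.commute)
  qed
  then show ?thesis using U by (auto simp: R_def)
qed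

lemma two_majorities_cover:
  fixes A B :: "int set"
  assumes p: "p > 0" and A: "A \<subseteq> {0..<p}" "p < 2 * int (card A)"
    and B: "B \<subseteq> {0..<p}" "p < 2 * int (card B)"
  shows "\<exists>a\<in>A. \<exists>b\<in>B. [a + b = x] (mod p)"
proof (rule ccontr)
  assume neg: "\<not> ?thesis"
  define B' where "B' = (\<lambda>b. (x - b) mod p) ` B"
  have fin: "finite A" "finite B" using A B finite_subset by blast+
  have "inj_on (\<lambda>b. (x - b) mod p) B"
  proof (rule inj_onI)
    fix b c assume bc: "b \<in> B" "c \<in> B" and "(x - b) mod p = (x - c) mod p"
    then have "(x - (x - b)) mod p = (x - (x - c)) mod p" by (metis mod_diff_right_eq)
    then show "b = c" using bc B by (auto simp: subset_iff)
  qed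
  then have "card B' = card B" by (simp add: B'_def card_image)
  moreover have "A \<inter> B' = {}"
  proof -
    have "((x - b) mod p + b) mod p = x mod p" for b by (simp add: mod_simps)
    then show ?thesis using neg by (auto simp: B'_def cong_def)
  qed
  moreover have "card (A \<union> B') \<le> card {0..<p}"
    using A p by (intro card_mono) (auto simp: B'_def)
  ultimately have "int (card A) + int (card B) \<le> p"
    using fin p by (simp add: card_Un_disjoint B'_def)
  then show False using A B by linarith
qed

text \<open>The elements are indexed by \<open>G \<times> N\<close>, and \<open>Q div (q * n)\<close> stands for \<open>1 / (q * n)\<close> modulo \<open>p\<close> up to the
unit \<open>Q\<close>. While at most half of the pairs are used, some \<open>n\<close> still has at least half of \<open>G\<close> available;
this half has product at least \<open>p\<close>, so the growth step applies to it. Two disjoint supplies \<open>N1\<close> and \<open>N2\<close> each give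
more than \<open>p / 2\<close> subset sums, and two such sets have all residues as sums.\<close>

lemma prime_denominator_cleared:
  fixes p Q L T :: nat and G N1 N2 :: "nat set"
  assumes p: "prime p" and pQ: "\<not> p dvd Q"
    and G: "finite G" "pairwise coprime G" "\<And>q. q \<in> G \<Longrightarrow> 0 < q \<and> q \<le> L"
    and big: "\<And>H. H \<subseteq> G \<Longrightarrow> card G \<le> 2 * card H \<Longrightarrow> p \<le> \<Prod>H"
    and N: "finite N1" "finite N2" "N1 \<inter> N2 = {}"
    and dvdQ: "\<And>n. n \<in> N1 \<union> N2 \<Longrightarrow> n * \<Prod>G dvd Q"
    and T: "2 * T \<le> card G * card N1" "2 * T \<le> card G * card N2"
    and growth: "p * (4 * card G * L) ^ T < (4 * card G * L + 1) ^ T"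
  shows "\<exists>S\<subseteq>G \<times> (N1 \<union> N2). card S \<le> 2 * T \<and>
    [(\<Sum>(q, n)\<in>S. int (Q div (q * n))) = x] (mod int p)"
proof -
  define v where "v = (\<lambda>(q, n). int (Q div (q * n)))"
  define \<kappa> where "\<kappa> = 4 * card G * L"
  have p0: "int p > 0" using p prime_gt_0_nat by simp
  have half: "\<exists>U\<subseteq>G \<times> N. card U \<le> T \<and>
      int p < 2 * int (card ((\<lambda>V. sum v V mod int p) ` Pow U))"
    if sub: "N \<subseteq> N1 \<union> N2" and T: "2 * T \<le> card G * card N" for N
  proof (rule greedy_subset_sums[OF p0, where \<kappa> = \<kappa>])
    have fN: "finite N" using sub N finite_subset by blast
    show "finite (G \<times> N)" using fN G by simp
    show "2 * T \<le> card (G \<times> N)" using T by (simp add: card_cartesian_product)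
    have "int (p * \<kappa> ^ T) < int ((\<kappa> + 1) ^ T)" using growth unfolding \<kappa>_def by (simp only: of_nat_less_iff)
    then show "int p * int \<kappa> ^ T < (int \<kappa> + 1) ^ T" by (simp add: add.commute)
    fix U A assume U: "U \<subseteq> G \<times> N" "2 * card U \<le> card (G \<times> N)"
      and A: "A \<subseteq> {0..<int p}" "2 * int (card A) \<le> int p"
    define F where "F n = {q \<in> G. (q, n) \<notin> U}" for n
    have "\<exists>n\<in>N. card G \<le> 2 * card (F n)"
    proof (rule ccontr)
      assume neg: "\<not> ?thesis"
      have Nne: "N \<noteq> {}"
      proof
        assume "N = {}"
        then have "T = 0" using T by simp
        then show False using growth p prime_gt_0_nat[OF p] by simp
      qed
      have "G \<times> N - U = (\<Union>n\<in>N. (\<lambda>q. (q, n)) ` F n)" by (auto simp: F_def)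
      then have "card (G \<times> N - U) \<le> (\<Sum>n\<in>N. card ((\<lambda>q. (q, n)) ` F n))"
        using card_UN_le[OF fN] by simp
      also have "\<dots> \<le> (\<Sum>n\<in>N. card (F n))"
        using G by (intro sum_mono card_image_le) (auto simp: F_def)
      finally have "2 * card (G \<times> N - U) \<le> (\<Sum>n\<in>N. 2 * card (F n))" by (simp flip: sum_distrib_left)
      also have "\<dots> < (\<Sum>n\<in>N. card G)" using neg fN Nne by (intro sum_strict_mono) auto
      also have "\<dots> = card (G \<times> N)" by (simp add: card_cartesian_product)
      finally show False using U fN G finite_subset[OF U(1)] by (simp add: card_Diff_subset)
    qed
    then obtain n where n: "n \<in> N" "card G \<le> 2 * card (F n)" by blast
    define H where "H = F n"
    have H: "H \<subseteq> G" "finite H" using G by (auto simp: H_def F_def)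
    have pH: "p \<le> \<Prod>H" using big H n by (simp add: H_def)
    then have Hne: "H \<noteq> {}" using prime_gt_1_nat[OF p] by auto
    have "n * \<Prod>H dvd n * \<Prod>G" using H G by (intro mult_dvd_mono prod_dvd_prod_subset) auto
    then have "n * \<Prod>H dvd Q" using dvdQ n sub by (blast intro: dvd_trans)
    then obtain e where e: "Q = n * \<Prod>H * e" by (elim dvdE)
    have ep: "coprime (int e) (int p)"
      using e pQ p by (metis coprime_commute coprime_int_iff dvd_triv_right dvd_trans prime_imp_coprime)
    have Qpos: "Q > 0" using pQ by (cases Q) auto
    have v: "v (q, n) = int e * int (\<Prod>(H - {q}))" if q: "q \<in> H" for q
    proof -
      have "\<Prod>H = q * \<Prod>(H - {q})" using q H by (simp add: prod.remove)
      then have "Q = (q * n) * (e * \<Prod>(H - {q}))" unfolding e by simp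
      moreover have "q * n > 0" using calculation Qpos by (intro Nat.gr0I) auto
      ultimately have "Q div (q * n) = e * \<Prod>(H - {q})" by simp
      then show ?thesis unfolding v_def by (simp only: split of_nat_mult)
    qed
    have "\<exists>q\<in>H. card A \<le> 4 * card H * L * escapes (int p) A (int e * int (\<Prod>(H - {q})))"
      using H G Hne pH ep A p0 unfolding of_nat_le_iff
      by (intro some_cofactor_shift_escapes) (auto simp del: of_nat_prod intro: pairwise_subset)
    then obtain q where q: "q \<in> H" "card A \<le> 4 * card H * L * escapes (int p) A (v (q, n))"
      using v by fastforce
    have "4 * card H * L * escapes (int p) A (v (q, n)) \<le> \<kappa> * escapes (int p) A (v (q, n))"
      unfolding \<kappa>_def using card_mono[OF G(1) H(1)] by (intro mult_le_mono) auto
    then have "card A \<le> \<kappa> * escapes (int p) A (v (q, n))" using q by linarith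
    then show "\<exists>i\<in>G \<times> N - U. card A \<le> \<kappa> * escapes (int p) A (v i)"
      using q n by (intro bexI[of _ "(q, n)"]) (auto simp: H_def F_def)
  qed
  obtain U1 where U1: "U1 \<subseteq> G \<times> N1" "card U1 \<le> T"
    "int p < 2 * int (card ((\<lambda>V. sum v V mod int p) ` Pow U1))" using half[of N1] T by auto
  obtain U2 where U2: "U2 \<subseteq> G \<times> N2" "card U2 \<le> T"
    "int p < 2 * int (card ((\<lambda>V. sum v V mod int p) ` Pow U2))" using half[of N2] T by auto
  have "\<exists>a\<in>(\<lambda>V. sum v V mod int p) ` Pow U1. \<exists>b\<in>(\<lambda>V. sum v V mod int p) ` Pow U2. [a + b = x] (mod int p)"
    using U1 U2 p0 by (intro two_majorities_cover) auto
  then obtain a b where a: "a \<in> (\<lambda>V. sum v V mod int p) ` Pow U1"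
    and b: "b \<in> (\<lambda>V. sum v V mod int p) ` Pow U2" and ab: "[a + b = x] (mod int p)" by blast
  obtain V1 V2 where V: "V1 \<subseteq> U1" "V2 \<subseteq> U2" "a = sum v V1 mod int p" "b = sum v V2 mod int p"
    using a b by blast
  then have x: "[sum v V1 mod int p + sum v V2 mod int p = x] (mod int p)" using ab by simp
  have fU: "finite U1" "finite U2" 
    using finite_subset[OF U1(1)] finite_subset[OF U2(1)] G(1) N(1,2) by auto
  have disj: "V1 \<inter> V2 = {}" using U1 U2 V N by blast
  have fV: "finite V1" "finite V2" using V fU finite_subset by blast+
  have "card (V1 \<union> V2) \<le> 2 * T"
    using card_Un_le[of V1 V2] card_mono[OF fU(1) V(1)] card_mono[OF fU(2) V(2)] U1 U2 by linarith
  moreover have "[sum v (V1 \<union> V2) = x] (mod int p)"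
    using x disj fV by (simp add: sum.union_disjoint cong_def mod_simps)
  moreover have "V1 \<union> V2 \<subseteq> G \<times> (N1 \<union> N2)" using U1 U2 V by blast
  ultimately show ?thesis unfolding v_def by blast
qed

section \<open>Denominators with small prime factors\<close>

text \<open>The odd primes occur to the first power only, so that a single step removes \<open>p\<close> from the denominator and the
cofactors used in that step involve smaller primes only. The power of 2 makes the
base case, binary expansion, as rich as needed.\<close>

definition modulus :: "nat \<Rightarrow> nat \<Rightarrow> nat" where
  "modulus t y = 2 ^ t * \<Prod>{p. prime p \<and> 2 < p \<and> p \<le> y}"

lemma modulus_pos: "modulus t y > 0"
  by (auto simp: modulus_def intro!: prod_pos)

lemma modulus_le_2: "y \<le> 2 \<Longrightarrow> modulus t y = 2 ^ t"
proof -
  assume "y \<le> 2"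
  then have "{p. prime p \<and> 2 < p \<and> p \<le> y} = {}" by auto
  then show ?thesis unfolding modulus_def by (simp only: prod.empty mult_1_right)
qed

lemma modulus_prime:
  assumes "prime (Suc y)" "2 < Suc y"
  shows "modulus t (Suc y) = Suc y * modulus t y"
proof -
  have "{p. prime p \<and> 2 < p \<and> p \<le> Suc y} = insert (Suc y) {p. prime p \<and> 2 < p \<and> p \<le> y}"
    using assms by (auto simp: le_Suc_eq)
  then have "\<Prod>{p. prime p \<and> 2 < p \<and> p \<le> Suc y} = Suc y * \<Prod>{p. prime p \<and> 2 < p \<and> p \<le> y}"
    by (simp del: mult_Suc)
  then show ?thesis unfolding modulus_def by (simp only: mult.left_commute)
qed

lemma modulus_not_prime: "\<not> prime (Suc y) \<Longrightarrow> modulus t (Suc y) = modulus t y"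
  unfolding modulus_def by (rule arg_cong[where f = "\<lambda>S. 2 ^ t * \<Prod>S"]) (auto simp: le_Suc_eq)

lemma prime_not_dvd_modulus:
  assumes "prime p" "2 < p" "y < p"
  shows "\<not> p dvd modulus t y"
proof
  assume "p dvd modulus t y"
  then have "p dvd 2 \<or> (\<exists>r\<in>{r. prime r \<and> 2 < r \<and> r \<le> y}. p dvd r)"
    using assms by (auto simp: modulus_def prime_dvd_mult_iff prime_dvd_prod_iff dest: prime_dvd_power)
  then show False using assms by (auto dest!: dvd_imp_le)
qed

lemma binary_representation:
  "s < 2 ^ Suc t \<Longrightarrow> \<exists>D. D \<subseteq> {d. d dvd 2 ^ t} \<and> \<Sum>D = (s::nat)"
proof (induction t arbitrary: s)
  case 0
  then have "s = 0 \<or> s = 1" by auto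
  then show ?case by (auto intro: exI[of _ "{}"] exI[of _ "{1}"])
next
  case (Suc t)
  show ?case
  proof (cases "s < 2 ^ Suc t")
    case True
    then obtain D where "D \<subseteq> {d. d dvd 2 ^ t}" "\<Sum>D = s" using Suc.IH by blast
    then show ?thesis by (intro exI[of _ D]) (auto intro: dvd_mult)
  next
    case False
    then have "s - 2 ^ Suc t < 2 ^ Suc t" using Suc.prems by auto
    then obtain D where D: "D \<subseteq> {d. d dvd 2 ^ t}" "\<Sum>D = s - 2 ^ Suc t" using Suc.IH by blast
    have "2 ^ Suc t \<notin> D" using D(1) by (auto dest!: dvd_imp_le)
    moreover have "finite D" using D(1) by (rule finite_subset) (simp add: finite_divisors_nat)
    ultimately have "\<Sum>(insert (2 ^ Suc t) D) = s" using D False by simp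
    then show ?thesis using D by (intro exI[of _ "insert (2 ^ Suc t) D"]) (auto intro: dvd_mult)
  qed
qed

text \<open>Euclid's argument: a prime factor of one plus the product of the primes up to \<open>y\<close> exceeds \<open>y\<close>. This crude
substitute for Bertrand's postulate is all that practicality needs.\<close>

lemma next_prime_le_modulus:
  assumes "prime (Suc y)" "2 \<le> y" "1 \<le> t"
  shows "Suc y \<le> 2 * modulus t y"
proof -
  define P where "P = modulus 1 y"
  have P: "P > 0" by (simp add: P_def modulus_pos)
  then obtain r where r: "prime r" "r dvd P + 1" using prime_factor_nat[of "P + 1"] by auto
  have "\<not> r \<le> y"
  proof
    assume "r \<le> y"
    then have "r dvd P"
      using r(1) prime_ge_2_nat[OF r(1)]
      by (cases "r = 2") (auto simp: P_def modulus_def intro!: dvd_mult dvd_prodI)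
    then have "r dvd 1" using r(2) by (metis dvd_add_right_iff)
    then show False using r(1) by simp
  qed
  then have "Suc y \<le> P + 1" using r by (auto dest!: dvd_imp_le)
  also have "\<dots> \<le> 2 * P" using P by simp
  also have "P \<le> modulus t y" unfolding P_def modulus_def using assms(3)
    by (intro mult_le_mono power_increasing) auto
  finally show ?thesis by simp
qed

text \<open>Passing from \<open>Q\<close> to \<open>p * Q\<close>: write \<open>s = p * u + v\<close> with \<open>v < p\<close>. Both \<open>u\<close> and \<open>v\<close> are less than
\<open>2 * Q\<close>, and the divisors \<open>p * d\<close> used for \<open>p * u\<close> differ from those used for \<open>v\<close>, which \<open>p\<close> does not divide.\<close>

lemma modulus_practical:
  assumes "1 \<le> t"
  shows "s < 2 * modulus t y \<Longrightarrow> \<exists>D. D \<subseteq> {d. d dvd modulus t y} \<and> \<Sum>D = s"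
proof (induction y arbitrary: s)
  case 0
  then show ?case using binary_representation[of s t] by (simp add: modulus_le_2)
next
  case (Suc y)
  consider "Suc y \<le> 2" | "2 < Suc y" "\<not> prime (Suc y)" | "2 < Suc y" "prime (Suc y)" by linarith
  then show ?case
  proof cases
    case 1
    then show ?thesis using Suc.prems binary_representation[of s t] by (simp add: modulus_le_2)
  next
    case 2
    then show ?thesis using Suc by (simp add: modulus_not_prime)
  next
    case 3
    define p where "p = Suc y"
    have p0: "p > 0" by (simp add: p_def)
    define Q where "Q = modulus t y"
    have Qp: "modulus t (Suc y) = p * Q" using modulus_prime 3 by (simp add: p_def Q_def)
    have "s mod p < 2 * Q"
      using next_prime_le_modulus[of y t] 3 assms by (simp add: p_def Q_def)
        (meson less_le_trans mod_less_divisor zero_less_Suc)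
    then obtain D where D: "D \<subseteq> {d. d dvd Q}" "\<Sum>D = s mod p" using Suc.IH by (auto simp: Q_def)
    have "s div p < 2 * Q"
      using Suc.prems unfolding Qp by (intro less_mult_imp_div_less) (simp add: ac_simps)
    then obtain E where E: "E \<subseteq> {d. d dvd Q}" "\<Sum>E = s div p" using Suc.IH by (auto simp: Q_def)
    have fin: "finite D" "finite E"
      using D(1) E(1) modulus_pos[of t y] by (auto simp: Q_def intro: finite_subset finite_divisors_nat)
    have "\<not> p dvd Q" using prime_not_dvd_modulus 3 by (simp add: p_def Q_def)
    then have "D \<inter> (*) p ` E = {}" using D by (auto dest: dvd_mult_left)
    then have "\<Sum>(D \<union> (*) p ` E) = s mod p + p * (s div p)"
      using fin D E p0 by (simp add: sum.union_disjoint sum.reindex inj_on_def sum_distrib_left[symmetric])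
    then have "\<Sum>(D \<union> (*) p ` E) = s" by simp
    moreover have "D \<union> (*) p ` E \<subseteq> {d. d dvd modulus t (Suc y)}"
      using D E unfolding Qp by (auto intro: dvd_mult mult_dvd_mono)
    ultimately show ?thesis by blast
  qed
qed

lemma divisor_sum_as_unit_fractions:
  fixes Q :: nat
  assumes Q: "Q > 0" and D: "D \<subseteq> {d. d dvd Q}"
  shows "\<exists>S. S \<subseteq> {m. m dvd Q} \<and> (\<Sum>m\<in>S. 1 / real m) = real (\<Sum>D) / real Q"
proof -
  have inj: "inj_on (\<lambda>d. Q div d) D"
  proof (rule inj_onI)
    fix d e assume de: "d \<in> D" "e \<in> D" "Q div d = Q div e"
    have "d dvd Q" "e dvd Q" using D de by auto
    then have "d * (Q div d) = Q" "e * (Q div e) = Q" by simp_all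
    then show "d = e" using Q de(3) by (metis mult_right_cancel mult_0_right less_irrefl)
  qed
  have "(\<Sum>m\<in>(\<lambda>d. Q div d) ` D. 1 / real m) = (\<Sum>d\<in>D. real d / real Q)"
    unfolding sum.reindex[OF inj] o_def
  proof (rule sum.cong)
    fix d assume "d \<in> D"
    then have "d dvd Q" using D by auto
    then show "1 / real (Q div d) = real d / real Q" by (simp add: real_of_nat_div)
  qed simp
  also have "\<dots> = real (\<Sum>D) / real Q" by (simp flip: sum_divide_distrib)
  finally have "(\<Sum>m\<in>(\<lambda>d. Q div d) ` D. 1 / real m) = real (\<Sum>D) / real Q" .
  moreover have "(\<lambda>d. Q div d) ` D \<subseteq> {m. m dvd Q}"
  proof (intro image_subsetI CollectI)
    fix d assume "d \<in> D"
    then have "d * (Q div d) = Q" using D by auto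
    then show "Q div d dvd Q" by (metis dvd_triv_right)
  qed
  ultimately show ?thesis by blast
qed

lemma modulus_unit_fractions:
  assumes "1 \<le> t" "s < 2 * modulus t y"
  shows "\<exists>S. S \<subseteq> {m. m dvd modulus t y} \<and> (\<Sum>m\<in>S. 1 / real m) = real s / real (modulus t y)"
  using modulus_practical[OF assms] divisor_sum_as_unit_fractions[OF modulus_pos] by metis

lemma dyadic_unit_fractions:
  assumes "s < 2 ^ Suc t"
  shows "\<exists>S. S \<subseteq> {m. m dvd 2 ^ t} \<and> (\<Sum>m\<in>S. 1 / real m) = real s / 2 ^ t"
proof -
  obtain D where "D \<subseteq> {d. d dvd 2 ^ t}" "\<Sum>D = s" using binary_representation[OF assms] by blast
  then show ?thesis using divisor_sum_as_unit_fractions[of "2 ^ t" D] by simp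
qed

lemma sum_cofactors:
  fixes Q :: nat
  assumes "\<And>m. m \<in> S \<Longrightarrow> m dvd Q"
  shows "real_of_int (\<Sum>m\<in>S. int (Q div m)) = real Q * (\<Sum>m\<in>S. 1 / real m)"
  unfolding of_int_sum sum_distrib_left
proof (rule sum.cong)
  fix m assume "m \<in> S"
  then show "real_of_int (int (Q div m)) = real Q * (1 / real m)"
    using assms[of m] real_of_nat_div[of m Q] by simp
qed simp

text \<open>The hypothesis \<open>step\<close> says that unit fractions of total at most \<open>cost p\<close> can adjust the numerator modulo \<open>p\<close>. The
lower bound on \<open>r\<close> keeps the remainder nonnegative throughout. Fractions subtracted at \<open>p\<close> have
denominators divisible by \<open>p\<close> and by no larger prime, hence all denominators are distinct.\<close>

lemma clear_primes_descending:
  fixes cost :: "nat \<Rightarrow> real"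
  assumes t: "2 ^ t \<le> M"
    and step: "\<And>p x. prime p \<Longrightarrow> 2 < p \<Longrightarrow> p \<le> y \<Longrightarrow> \<exists>S.
      S \<subseteq> {p * d | d. d dvd modulus t (p - 1)} \<and> (\<forall>m\<in>S. m \<le> M) \<and> (\<Sum>m\<in>S. 1 / real m) \<le> cost p \<and>
      [(\<Sum>m\<in>S. int (modulus t p div m)) = x] (mod int p)"
    and r: "(\<Sum>p | prime p \<and> 2 < p \<and> p \<le> y. cost p) * real (modulus t y) \<le> real r" "r < 2 * modulus t y"
  shows "\<exists>S. S \<subseteq> {m. m dvd modulus t y} \<and> (\<forall>m\<in>S. m \<le> M) \<and>
      (\<Sum>m\<in>S. 1 / real m) = real r / real (modulus t y)"
  using step r
proof (induction y arbitrary: r)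
  have small: "\<exists>S. S \<subseteq> {m. m dvd modulus t y} \<and> (\<forall>m\<in>S. m \<le> M) \<and>
      (\<Sum>m\<in>S. 1 / real m) = real r / real (modulus t y)" if y2: "y \<le> 2" and r2: "r < 2 * modulus t y" for y r
  proof -
    have M: "m \<le> M" if "m dvd 2 ^ t" for m using dvd_imp_le[OF that] t by simp
    obtain S where "S \<subseteq> {m. m dvd 2 ^ t}" "(\<Sum>m\<in>S. 1 / real m) = real r / 2 ^ t"
      using dyadic_unit_fractions[of r t] r2 unfolding modulus_le_2[OF y2] power_Suc by blast
    then show ?thesis using y2 M by (intro exI[of _ S]) (auto simp: modulus_le_2)
  qed
  {
    case 0
    then show ?case using small[of 0 r] by auto
  next
    case (Suc y)
    consider "Suc y \<le> 2" | "2 < Suc y" "\<not> prime (Suc y)" | "2 < Suc y" "prime (Suc y)" by linarith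
    then show ?case
    proof cases
      case 1
      then show ?thesis using Suc.prems(3) small[of "Suc y" r] by auto
    next
      case 2
      have "{p. prime p \<and> 2 < p \<and> p \<le> Suc y} = {p. prime p \<and> 2 < p \<and> p \<le> y}"
        using 2 by (auto simp: le_Suc_eq)
      then have "(\<Sum>p | prime p \<and> 2 < p \<and> p \<le> y. cost p) * real (modulus t y) \<le> real r"
        using Suc.prems(2) modulus_not_prime[OF 2(2)] by simp
      moreover have "r < 2 * modulus t y" using Suc.prems(3) modulus_not_prime[OF 2(2)] by simp
      ultimately show ?thesis
        unfolding modulus_not_prime[OF 2(2)] by (intro Suc.IH Suc.prems(1)) auto
    next
      case 3
      define p where "p = Suc y"
      define Q where "Q = modulus t y"
      have Qp: "modulus t (Suc y) = p * Q" using modulus_prime 3 by (simp add: p_def Q_def)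
      have Q: "Q > 0" by (simp add: Q_def modulus_pos)
      have p: "p > 0" by (simp add: p_def)
      obtain S where S: "S \<subseteq> {p * d | d. d dvd Q}" "\<forall>m\<in>S. m \<le> M" "(\<Sum>m\<in>S. 1 / real m) \<le> cost p"
        "[(\<Sum>m\<in>S. int (p * Q div m)) = int r] (mod int p)"
        using Suc.prems(1)[of p "int r"] 3 Qp by (auto simp: p_def Q_def)
      have Sdvd: "m dvd p * Q" if "m \<in> S" for m using S(1) that by (auto intro: mult_dvd_mono)
      have fS: "finite S"
        by (rule finite_subset[of _ "{m. m dvd p * Q}"]) (use Sdvd p Q in auto)
      have \<sigma>: "real_of_int (\<Sum>m\<in>S. int (p * Q div m)) = real (p * Q) * (\<Sum>m\<in>S. 1 / real m)"
        using Sdvd by (rule sum_cofactors)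
      obtain r' where r': "int r = (\<Sum>m\<in>S. int (p * Q div m)) + int p * r'"
        using S(4) by (auto simp: cong_iff_lin)
      have "real r = real (p * Q) * (\<Sum>m\<in>S. 1 / real m) + real p * real_of_int r'"
        using arg_cong[OF r', of real_of_int] \<sigma> by simp
      then have rr: "real r / (p * Q) = (\<Sum>m\<in>S. 1 / real m) + real_of_int r' / Q"
        using p Q by (simp add: field_simps)
      have ins: "{q. prime q \<and> 2 < q \<and> q \<le> Suc y} = insert p {q. prime q \<and> 2 < q \<and> q \<le> y}"
        using 3 by (auto simp: le_Suc_eq p_def)
      have "cost p + (\<Sum>p | prime p \<and> 2 < p \<and> p \<le> y. cost p) \<le> real r / (p * Q)"
      proof (subst pos_le_divide_eq)
        show "0 < real (p * Q)" using p Q by simp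
        have "p \<notin> {q. prime q \<and> 2 < q \<and> q \<le> y}" by (simp add: p_def)
        then show "(cost p + (\<Sum>p | prime p \<and> 2 < p \<and> p \<le> y. cost p)) * real (p * Q) \<le> real r"
          using Suc.prems(2) unfolding Qp ins by (subst (asm) sum.insert) auto
      qed
      then have lower: "(\<Sum>p | prime p \<and> 2 < p \<and> p \<le> y. cost p) \<le> real_of_int r' / Q"
        using rr S(3) by linarith
      have "0 \<le> cost q" if "q \<in> {p. prime p \<and> 2 < p \<and> p \<le> y}" for q
      proof -
        have "prime q" "2 < q" "q \<le> Suc y" using that by auto
        then obtain S where "(\<Sum>m\<in>S. 1 / real m) \<le> cost q" using Suc.prems(1)[of q 0] by blast
        moreover have "0 \<le> (\<Sum>m\<in>S. 1 / real m)" by (intro sum_nonneg) auto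
        ultimately show ?thesis by linarith
      qed
      then have "0 \<le> (\<Sum>p | prime p \<and> 2 < p \<and> p \<le> y. cost p)" by (intro sum_nonneg) auto
      then have "0 \<le> real_of_int r' / Q" using lower by linarith
      then have r'0: "r' \<ge> 0" using Q by (simp add: zero_le_divide_iff)
      have "real r < 2 * (p * Q)" using Suc.prems(3) Qp by (metis of_nat_less_iff of_nat_mult of_nat_numeral)
      then have "real r / (p * Q) < 2" using p Q by (simp add: field_simps)
      moreover have "0 \<le> (\<Sum>m\<in>S. 1 / real m)" by (intro sum_nonneg) auto
      ultimately have "real_of_int r' / Q < 2" using rr by linarith
      then have "real_of_int r' < 2 * real Q" using Q by (simp add: field_simps)
      then have upper: "nat r' < 2 * Q" using r'0 by linarith
      have "\<exists>S'. S' \<subseteq> {m. m dvd Q} \<and> (\<forall>m\<in>S'. m \<le> M) \<and> (\<Sum>m\<in>S'. 1 / real m) = real (nat r') / real Q"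
        unfolding Q_def
      proof (rule Suc.IH)
        show "(\<Sum>p | prime p \<and> 2 < p \<and> p \<le> y. cost p) * real (modulus t y) \<le> real (nat r')"
          using lower Q r'0 by (simp add: Q_def[symmetric] field_simps)
      qed (use upper Suc.prems(1) in \<open>auto simp: Q_def\<close>)
      then obtain S' where S': "S' \<subseteq> {m. m dvd Q}" "\<forall>m\<in>S'. m \<le> M"
        "(\<Sum>m\<in>S'. 1 / real m) = real (nat r') / real Q" by blast
      have "\<not> p dvd Q" using prime_not_dvd_modulus 3 by (simp add: p_def Q_def)
      then have "S \<inter> S' = {}" using S(1) S'(1) by (auto dest: dvd_mult_left)
      moreover have "finite S'" using S'(1) Q by (auto intro: finite_subset)
      ultimately have "(\<Sum>m\<in>S \<union> S'. 1 / real m) = real r / real (p * Q)"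
        using fS S'(3) rr r'0 by (simp add: sum.union_disjoint)
      then show ?thesis using S S' Sdvd unfolding Qp by (intro exI[of _ "S \<union> S'"]) auto
    qed
  }
qed

section \<open>Clearing a single prime\<close>

text \<open>Binary digits of a residue \<open>v < p\<close>: the fraction spent is \<open>v / (p * 2 ^ t) < 1 / 2 ^ t\<close>.\<close>

lemma small_prime_step:
  assumes p: "prime p" "2 < p" and t: "p \<le> 2 ^ Suc t" and M: "p * 2 ^ t \<le> M"
  shows "\<exists>S. S \<subseteq> {p * d | d. d dvd modulus t (p - 1)} \<and> (\<forall>m\<in>S. m \<le> M) \<and>
    (\<Sum>m\<in>S. 1 / real m) \<le> 1 / 2 ^ t \<and> [(\<Sum>m\<in>S. int (modulus t p div m)) = x] (mod int p)"
proof -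
  define W where "W = \<Prod>{r. prime r \<and> 2 < r \<and> r \<le> p - 1}"
  have mod: "modulus t (p - 1) = 2 ^ t * W" by (simp add: modulus_def W_def)
  have modp: "modulus t p = p * (2 ^ t * W)" using modulus_prime[of "p - 1" t] p mod by simp
  have "\<not> p dvd 2 ^ t * W" using prime_not_dvd_modulus[of p "p - 1" t] p mod by simp
  then have "coprime (int W) (int p)"
    using p by (metis coprime_commute coprime_int_iff dvd_mult prime_imp_coprime)
  then obtain u where u: "[int W * u = 1] (mod int p)" using cong_solve_coprime_int by blast
  define v where "v = nat ((x * u) mod int p)"
  have p0: "int p > 0" using p by simp
  have v: "int v = (x * u) mod int p" using p0 by (simp add: v_def)
  then have "int v < int p" using p0 by simp
  then have "v < p" by simp
  then obtain S where S: "S \<subseteq> {m. m dvd 2 ^ t}" "(\<Sum>m\<in>S. 1 / real m) = real v / 2 ^ t"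
    using dyadic_unit_fractions[of v t] t by auto
  define S' where "S' = (*) p ` S"
  have sub: "S' \<subseteq> {p * d | d. d dvd modulus t (p - 1)}" unfolding S'_def mod using S(1) by (auto intro: dvd_mult2)
  have "m \<le> M" if "m \<in> S'" for m
  proof -
    obtain d where "m = p * d" "d dvd 2 ^ t" using \<open>m \<in> S'\<close> S by (auto simp: S'_def)
    then have "m \<le> p * 2 ^ t" by (auto dest!: dvd_imp_le)
    then show ?thesis using M by simp
  qed
  moreover have sum: "(\<Sum>m\<in>S'. 1 / real m) = real v / 2 ^ t / p"
  proof -
    have "(\<Sum>m\<in>S'. 1 / real m) = (\<Sum>m\<in>S. 1 / real m / p)"
      unfolding S'_def using p by (subst sum.reindex) (auto simp: inj_on_def field_simps)
    also have "\<dots> = real v / 2 ^ t / p" unfolding sum_divide_distrib[symmetric] S(2) ..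
    finally show ?thesis .
  qed
  moreover have "real v / 2 ^ t / p \<le> 1 / 2 ^ t" using \<open>v < p\<close> by (simp add: field_simps)
  moreover have "[(\<Sum>m\<in>S'. int (modulus t p div m)) = x] (mod int p)"
  proof -
    have "real_of_int (\<Sum>m\<in>S'. int (modulus t p div m)) = real (modulus t p) * (real v / 2 ^ t / p)"
      unfolding sum[symmetric] using sub unfolding modp mod by (intro sum_cofactors) auto
    also have "\<dots> = real_of_int (int (W * v))" using p by (simp add: modp)
    finally have "(\<Sum>m\<in>S'. int (modulus t p div m)) = int (W * v)" by (simp only: of_int_eq_iff)
    moreover have "[int W * int v = int W * (x * u)] (mod int p)"
      unfolding v by (simp add: cong_def mod_simps)
    moreover have "[int W * (x * u) = x * 1] (mod int p)"
      using cong_scalar_left[OF u, of x] by (simp add: ac_simps)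
    ultimately show ?thesis by (metis cong_trans mult.right_neutral of_nat_mult)
  qed
  ultimately show ?thesis using sub by (intro exI[of _ S'] conjI ballI) simp_all
qed

text \<open>The size conditions make all \<open>q\<close> smaller than all \<open>n\<close>, so a product \<open>q * n\<close> determines its
factors, and they make all of them smaller than \<open>p\<close>, so that \<open>n * \<Prod>G\<close> divides the part of the modulus below \<open>p\<close>.
The lower bounds \<open>L0\<close> and \<open>N0\<close> control the total of the fractions spent.\<close>

lemma large_prime_step:
  fixes G N1 N2 :: "nat set"
  assumes p: "prime p" "2 < p"
    and G: "finite G" "\<And>q. q \<in> G \<Longrightarrow> prime q \<and> L0 < q \<and> q \<le> L"
    and N: "finite N1" "finite N2" "N1 \<inter> N2 = {}"
      "\<And>n. n \<in> N1 \<union> N2 \<Longrightarrow> prime n \<and> N0 < n \<and> n \<le> N"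
    and order: "2 \<le> L0" "L \<le> N0" "2 \<le> N0" "N < p"
    and big: "\<And>H. H \<subseteq> G \<Longrightarrow> card G \<le> 2 * card H \<Longrightarrow> p \<le> \<Prod>H"
    and T: "2 * T \<le> card G * card N1" "2 * T \<le> card G * card N2"
    and growth: "p * (4 * card G * L) ^ T < (4 * card G * L + 1) ^ T"
    and M: "p * (L * N) \<le> M"
  shows "\<exists>S. S \<subseteq> {p * d | d. d dvd modulus t (p - 1)} \<and> (\<forall>m\<in>S. m \<le> M) \<and>
    (\<Sum>m\<in>S. 1 / real m) \<le> real (2 * T) / (real L0 * real N0) / real p \<and>
    [(\<Sum>m\<in>S. int (modulus t p div m)) = x] (mod int p)"
proof -
  define Q where "Q = modulus t (p - 1)"
  have Qp: "modulus t p = p * Q" using modulus_prime[of "p - 1" t] p by (simp add: Q_def)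
  have pQ: "\<not> p dvd Q" unfolding Q_def by (rule prime_not_dvd_modulus) (use p in auto)
  have dvdQ: "n * \<Prod>G dvd Q" if n: "n \<in> N1 \<union> N2" for n
  proof -
    have "n \<notin> G" using G N(4)[OF n] order by fastforce
    then have "n * \<Prod>G = \<Prod>(insert n G)" using G by simp
    also have "\<dots> dvd \<Prod>{r. prime r \<and> 2 < r \<and> r \<le> p - 1}"
    proof (rule prod_dvd_prod_subset)
      show "insert n G \<subseteq> {r. prime r \<and> 2 < r \<and> r \<le> p - 1}"
      proof
        fix r assume r: "r \<in> insert n G"
        show "r \<in> {r. prime r \<and> 2 < r \<and> r \<le> p - 1}"
        proof (cases "r = n")
          case True
          then show ?thesis using N(4)[OF n] order G(2) by auto
        next
          case False
          then show ?thesis using N(4)[OF n] order G(2)[of r] r by auto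
        qed
      qed
    qed simp
    finally show ?thesis by (simp add: Q_def modulus_def)
  qed
  have "pairwise coprime G" using G by (auto simp: pairwise_def intro: primes_coprime)
  moreover have "0 < q \<and> q \<le> L" if "q \<in> G" for q using G(2)[OF that] by simp
  ultimately have "\<exists>S\<subseteq>G \<times> (N1 \<union> N2). card S \<le> 2 * T \<and>
      [(\<Sum>(q, n)\<in>S. int (Q div (q * n))) = x] (mod int p)"
    by (rule prime_denominator_cleared[OF p(1) pQ G(1) _ _ big N(1-3) dvdQ T growth])
  then obtain S where S: "S \<subseteq> G \<times> (N1 \<union> N2)" "card S \<le> 2 * T"
    "[(\<Sum>(q, n)\<in>S. int (Q div (q * n))) = x] (mod int p)" by (elim exE conjE) (rule that)
  define f where "f = (\<lambda>(q, n). p * (q * n))"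
  have inj: "inj_on f S"
  proof (rule inj_onI)
    fix s s' assume s: "s \<in> S" "s' \<in> S" and eq: "f s = f s'"
    obtain q n q' n' where [simp]: "s = (q, n)" "s' = (q', n')" by force
    have mem: "q \<in> G" "q' \<in> G" "n \<in> N1 \<union> N2" "n' \<in> N1 \<union> N2"
      using subsetD[OF S(1) s(1)] subsetD[OF S(1) s(2)] by auto
    have q: "prime q" "prime q'" "q \<le> L" "q' \<le> L" using G(2) mem by auto
    have n: "prime n" "prime n'" "N0 < n" "N0 < n'" using N(4) mem by auto
    have eq': "q * n = q' * n'" using eq p by (simp add: f_def)
    then have "q dvd q' * n'" by (metis dvd_triv_left)
    then have "q dvd q' \<or> q dvd n'" using q(1) by (rule prime_dvd_multD[rotated])
    moreover have "\<not> q dvd n'" using primes_dvd_imp_eq[OF q(1) n(2)] q(3) n(4) order(2) by linarith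
    ultimately have "q = q'" using primes_dvd_imp_eq[OF q(1,2)] by blast
    moreover have "q > 0" using q(1) by (rule prime_gt_0_nat)
    ultimately show "s = s'" using eq' by simp
  qed
  have elem: "\<exists>q n. q \<in> G \<and> n \<in> N1 \<union> N2 \<and> s = (q, n)" if "s \<in> S" for s
    using subsetD[OF S(1) that] by (elim SigmaE) blast
  have fdvd: "f s \<in> {p * d | d. d dvd Q}" if "s \<in> S" for s
  proof -
    obtain q n where s: "q \<in> G" "n \<in> N1 \<union> N2" "s = (q, n)" using elem[OF \<open>s \<in> S\<close>] by blast
    have "q * n dvd \<Prod>G * n" using s G by (intro mult_dvd_mono dvd_prodI) auto
    also have "\<Prod>G * n dvd Q" using dvdQ[OF s(2)] by (simp add: mult.commute)
    finally show ?thesis using s by (auto simp: f_def)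
  qed
  have sub: "f ` S \<subseteq> {p * d | d. d dvd modulus t (p - 1)}" using fdvd by (auto simp: Q_def)
  moreover have "\<forall>m\<in>f ` S. m \<le> M"
  proof
    fix m assume "m \<in> f ` S"
    then obtain s' where s': "s' \<in> S" "m = f s'" by blast
    then obtain q n where s: "q \<in> G" "n \<in> N1 \<union> N2" "s' = (q, n)" using elem[OF s'(1)] by blast
    have "p * (q * n) \<le> p * (L * N)" using G(2)[OF s(1)] N(4)[OF s(2)] by (intro mult_le_mono) auto
    also have "\<dots> \<le> M" by (rule M)
    finally show "m \<le> M" using s s' by (simp add: f_def)
  qed
  moreover have "(\<Sum>m\<in>f ` S. 1 / real m) \<le> real (2 * T) / (real L0 * real N0) / real p"
  proof -
    have "(\<Sum>m\<in>f ` S. 1 / real m) = (\<Sum>s\<in>S. 1 / real (f s))" using inj by (simp add: sum.reindex)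
    also have "\<dots> \<le> (\<Sum>s\<in>S. 1 / (real L0 * real N0) / real p)"
    proof (rule sum_mono)
      fix s assume "s \<in> S"
      then obtain q n where s: "q \<in> G" "n \<in> N1 \<union> N2" "s = (q, n)" using elem[OF \<open>s \<in> S\<close>] by blast
      have "real L0 * real N0 \<le> real q * real n"
        using G(2)[OF s(1)] N(4)[OF s(2)] by (intro mult_mono) auto
      moreover have "real L0 * real N0 > 0" using order by simp
      ultimately have "1 / (real q * real n) \<le> 1 / (real L0 * real N0)"
        by (intro divide_left_mono) auto
      then have "1 / (real q * real n) / real p \<le> 1 / (real L0 * real N0) / real p"
        by (rule divide_right_mono) simp
      then show "1 / real (f s) \<le> 1 / (real L0 * real N0) / real p"
        using s by (simp add: f_def mult.commute)
    qed
    also have "\<dots> = real (card S) * (1 / (real L0 * real N0) / real p)" by simp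
    also have "\<dots> \<le> real (2 * T) * (1 / (real L0 * real N0) / real p)"
      using S(2) by (intro mult_right_mono) auto
    finally show ?thesis by simp
  qed
  moreover have "[(\<Sum>m\<in>f ` S. int (modulus t p div m)) = x] (mod int p)"
  proof -
    have "(\<Sum>m\<in>f ` S. int (modulus t p div m)) = (\<Sum>(q, n)\<in>S. int (Q div (q * n)))"
      unfolding sum.reindex[OF inj] o_def Qp using p by (intro sum.cong) (auto simp: f_def)
    then show ?thesis using S(3) by simp
  qed
  ultimately show ?thesis by (intro exI[of _ "f ` S"] conjI)
qed

text \<open>The budget of \<open>1 / 2\<close>: the primes up to \<open>z\<close> cost at most \<open>z / 2 ^ t = 1 / 8\<close>. A prime \<open>p\<close> beyond \<open>z\<close> costs
at most \<open>1 / (16 * p)\<close>, and these costs add up to at most \<open>1 / 4\<close>.\<close>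

lemma fractions_in_upper_half:
  fixes G N1 N2 :: "nat set"
  assumes z: "2 \<le> z" "2 ^ t = 8 * z" and y: "y \<le> z\<^sup>2"
    and G: "finite G" "\<And>q. q \<in> G \<Longrightarrow> prime q \<and> L0 < q \<and> q \<le> L"
    and N: "finite N1" "finite N2" "N1 \<inter> N2 = {}"
      "\<And>n. n \<in> N1 \<union> N2 \<Longrightarrow> prime n \<and> N0 < n \<and> n \<le> N"
    and order: "2 \<le> L0" "L \<le> N0" "2 \<le> N0" "N \<le> z"
    and big: "\<And>H. H \<subseteq> G \<Longrightarrow> card G \<le> 2 * card H \<Longrightarrow> z\<^sup>2 \<le> \<Prod>H"
    and T: "2 * T \<le> card G * card N1" "2 * T \<le> card G * card N2" "32 * T \<le> L0 * N0"
    and growth: "z\<^sup>2 * (4 * card G * L) ^ T < (4 * card G * L + 1) ^ T"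
    and M: "z\<^sup>2 * (L * N) \<le> M" "8 * z\<^sup>2 \<le> M"
    and r: "modulus t y \<le> 2 * r" "r < 2 * modulus t y"
  shows "\<exists>S. S \<subseteq> {m. m dvd modulus t y} \<and> (\<forall>m\<in>S. m \<le> M) \<and>
      (\<Sum>m\<in>S. 1 / real m) = real r / real (modulus t y)"
proof -
  define \<delta> where "\<delta> = real (2 * T) / (real L0 * real N0)"
  define cost where "cost p = (if p \<le> z then 1 / 2 ^ t else \<delta> / real p)" for p
  have L0N0: "real L0 * real N0 > 0" using order by simp
  have "real (32 * T) \<le> real (L0 * N0)" using T(3) by (simp only: of_nat_le_iff)
  then have \<delta>: "\<delta> \<le> 1 / 16" "\<delta> \<ge> 0" using L0N0 by (auto simp: \<delta>_def field_simps)
  have t: "2 ^ t \<le> M"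
  proof -
    have "8 * z \<le> 8 * z\<^sup>2" using z by (simp add: power2_eq_square)
    then show ?thesis using M z by simp
  qed
  have step: "\<exists>S. S \<subseteq> {p * d | d. d dvd modulus t (p - 1)} \<and> (\<forall>m\<in>S. m \<le> M) \<and>
      (\<Sum>m\<in>S. 1 / real m) \<le> cost p \<and> [(\<Sum>m\<in>S. int (modulus t p div m)) = x] (mod int p)"
    if p: "prime p" "2 < p" "p \<le> y" for p x
  proof (cases "p \<le> z")
    case True
    have "p * 2 ^ t \<le> M"
    proof -
      have "p * 2 ^ t \<le> z * (8 * z)" unfolding z(2)[symmetric] using True by (rule mult_le_mono1)
      then show ?thesis using M(2) by (simp add: power2_eq_square)
    qed
    then show ?thesis using small_prime_step[of p t M x] p True z by (simp add: cost_def)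
  next
    case False
    have py: "p \<le> z\<^sup>2" using p y by simp
    have "\<exists>S. S \<subseteq> {p * d | d. d dvd modulus t (p - 1)} \<and> (\<forall>m\<in>S. m \<le> M) \<and>
      (\<Sum>m\<in>S. 1 / real m) \<le> real (2 * T) / (real L0 * real N0) / real p \<and>
      [(\<Sum>m\<in>S. int (modulus t p div m)) = x] (mod int p)"
    proof (rule large_prime_step[OF p(1,2) G N order(1-3) _ _ T(1,2)])
      show "N < p" using False order(4) by simp
      show "p \<le> \<Prod>H" if "H \<subseteq> G" "card G \<le> 2 * card H" for H using big[OF that] py by simp
      show "p * (4 * card G * L) ^ T < (4 * card G * L + 1) ^ T"
        using growth mult_le_mono1[OF py, of "(4 * card G * L) ^ T"] by linarith
      show "p * (L * N) \<le> M" using M(1) mult_le_mono1[OF py, of "L * N"] by linarith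
    qed
    then show ?thesis using False by (simp add: cost_def \<delta>_def)
  qed
  have "(\<Sum>p | prime p \<and> 2 < p \<and> p \<le> y. cost p)
      \<le> (\<Sum>p\<in>{1..z} \<union> {p. prime p \<and> z < p \<and> p \<le> z\<^sup>2}. cost p)"
    using \<delta> y by (intro sum_mono2) (auto simp: cost_def)
  also have "\<dots> = (\<Sum>p\<in>{1..z}. cost p) + (\<Sum>p | prime p \<and> z < p \<and> p \<le> z\<^sup>2. cost p)"
    by (intro sum.union_disjoint) auto
  also have "(\<Sum>p\<in>{1..z}. cost p) = 1 / 8"
  proof -
    have "real (2 ^ t) = real (8 * z)" using z(2) by (simp only:)
    then have "(2::real) ^ t = 8 * real z" by simp
    then show ?thesis using z(1) by (simp add: cost_def)
  qed
  also have "(\<Sum>p | prime p \<and> z < p \<and> p \<le> z\<^sup>2. cost p)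
      = \<delta> * (\<Sum>p | prime p \<and> z < p \<and> p \<le> z\<^sup>2. 1 / real p)"
    unfolding sum_distrib_left by (intro sum.cong) (auto simp: cost_def)
  also have "\<dots> \<le> 1 / 16 * 4"
    using \<delta> sum_inverse_primes_square_window[OF z(1)] by (intro mult_mono sum_nonneg) auto
  finally have "(\<Sum>p | prime p \<and> 2 < p \<and> p \<le> y. cost p) \<le> 1 / 2" by simp
  then have "(\<Sum>p | prime p \<and> 2 < p \<and> p \<le> y. cost p) * real (modulus t y) \<le> 1 / 2 * real (modulus t y)"
    by (intro mult_right_mono) auto
  also have "\<dots> \<le> real r" using r(1) by linarith
  finally show ?thesis using clear_primes_descending[of t M y cost r] t step r(2) by blast
qed

section \<open>From the modulus to the given denominator\<close>

text \<open>Splitting off \<open>r\<close> congruent to \<open>a * Q\<close> modulo \<open>b\<close> gives \<open>a / b = s / Q + r / (b * Q)\<close>. When \<open>b\<close> does not divide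
\<open>Q\<close>, a multiple of \<open>b\<close> cannot divide \<open>Q\<close>, so the two families of denominators cannot meet. The
denominator 1 cannot occur for \<open>s / Q\<close>, since \<open>s < Q\<close>.\<close>

lemma unit_fractions_from_modulus:
  fixes a b Q M :: nat
  assumes ab: "1 \<le> a" "a < b" and Q: "even Q" "2 * b \<le> Q" "Q \<le> b * M"
    and all: "\<And>s. s < Q \<Longrightarrow> \<exists>S. S \<subseteq> {m. m dvd Q} \<and> (\<Sum>m\<in>S. 1 / real m) = real s / real Q"
    and upper: "\<And>r. Q \<le> 2 * r \<Longrightarrow> r < Q \<Longrightarrow> \<exists>S. S \<subseteq> {m. m dvd Q} \<and> (\<forall>m\<in>S. m \<le> M) \<and>
      (\<Sum>m\<in>S. 1 / real m) = real r / real Q"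
  shows "\<exists>S. S \<subseteq> {2..b * M} \<and> (\<Sum>m\<in>S. 1 / real m) = real a / real b"
proof -
  have pos: "Q > 0" "b > 0" using ab Q by auto
  have proper: "S \<subseteq> {2..b * M}"
    if S: "S \<subseteq> {m. m dvd Q}" "(\<Sum>m\<in>S. 1 / real m) < 1" for S
  proof
    fix m assume m: "m \<in> S"
    then have "m dvd Q" using S by auto
    then have "m > 0" "m \<le> Q" using pos by (auto dest: dvd_imp_le dvd_pos_nat)
    moreover have "m \<noteq> 1"
    proof
      assume "m = 1"
      have "finite S" using S(1) pos by (auto intro: finite_subset)
      then have "1 / real m \<le> (\<Sum>m\<in>S. 1 / real m)" using m by (intro member_le_sum) auto
      then show False using S \<open>m = 1\<close> by simp
    qed
    ultimately show "m \<in> {2..b * M}" using Q by auto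
  qed
  show ?thesis
  proof (cases "b dvd Q")
    case True
    then obtain c where c: "Q = b * c" by (elim dvdE)
    have "a * c < Q" using c ab pos by simp
    then obtain S where S: "S \<subseteq> {m. m dvd Q}" "(\<Sum>m\<in>S. 1 / real m) = real (a * c) / real Q"
      using all by blast
    have "real (a * c) / real Q = real a / real b" using c pos by (auto simp: field_simps)
    then show ?thesis using S proper[of S] ab by auto
  next
    case False
    obtain h where h: "Q = 2 * h" using Q(1) by (elim evenE)
    define r where "r = h + nat ((int (a * Q) - int h) mod int b)"
    have res: "int r = int h + (int (a * Q) - int h) mod int b" using pos by (simp add: r_def)
    then have "int r < int h + int b" "int h \<le> int r" using pos by auto
    then have r: "Q \<le> 2 * r" "r < Q" using h Q(2) by auto
    have "[int r = int (a * Q)] (mod int b)" unfolding res by (simp add: cong_def mod_simps)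
    then have "[a * Q = r] (mod b)" by (simp only: cong_int_iff cong_sym_eq)
    moreover have "r \<le> a * Q" using r(2) ab by (metis le_trans less_imp_le_nat mult_le_mono1 nat_mult_1)
    ultimately have "b dvd a * Q - r" by (simp add: cong_altdef_nat)
    then obtain s where s: "a * Q - r = b * s" by (elim dvdE)
    then have aQ: "a * Q = b * s + r" using \<open>r \<le> a * Q\<close> by simp
    have "b * s < b * Q"
    proof -
      have "b * s \<le> a * Q" using aQ by simp
      also have "\<dots> < b * Q" using ab pos by simp
      finally show ?thesis .
    qed
    then have sQ: "s < Q" by simp
    obtain S where S: "S \<subseteq> {m. m dvd Q}" "(\<Sum>m\<in>S. 1 / real m) = real s / real Q"
      using all[OF sQ] by blast
    obtain R where R: "R \<subseteq> {m. m dvd Q}" "\<forall>m\<in>R. m \<le> M" "(\<Sum>m\<in>R. 1 / real m) = real r / real Q"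
      using upper[OF r] by blast
    have fin: "finite S" "finite R" using S(1) R(1) pos by (auto intro: finite_subset)
    have "S \<inter> (*) b ` R = {}" using S(1) False by (auto dest: dvd_mult_left)
    then have "(\<Sum>m\<in>S \<union> (*) b ` R. 1 / real m) = real s / real Q + (\<Sum>m\<in>R. 1 / real m / real b)"
      using fin pos S(2) by (simp add: sum.union_disjoint sum.reindex inj_on_def mult.commute)
    also have "\<dots> = real s / real Q + real r / real Q / real b"
      unfolding sum_divide_distrib[symmetric] R(3) ..
    also have "\<dots> = real (b * s + r) / (real b * real Q)" using pos by (simp add: field_simps)
    also have "\<dots> = real a / real b" unfolding aQ[symmetric] using pos by simp
    finally have "(\<Sum>m\<in>S \<union> (*) b ` R. 1 / real m) = real a / real b" .
    moreover have "S \<subseteq> {2..b * M}" using S sQ pos by (intro proper) auto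
    moreover have "(*) b ` R \<subseteq> {2..b * M}"
    proof (intro image_subsetI)
      fix m assume m: "m \<in> R"
      then have "m dvd Q" using R by auto
      then have "m > 0" using pos by (auto intro: dvd_pos_nat)
      then have "b * 1 \<le> b * m" by (intro mult_le_mono) auto
      then have "2 \<le> b * m" using ab by linarith
      then show "b * m \<in> {2..b * M}" using ab R(2) m by auto
    qed
    ultimately show ?thesis by (intro exI[of _ "S \<union> (*) b ` R"]) auto
  qed
qed

section \<open>Choice of the parameters\<close>

text \<open>Chebyshev's lower bound in a form free of logarithms; \<open>s\<close> plays the role of the binary logarithm of \<open>n\<close>, and \<open>m\<close> is the
trivial bound for the number of primes that the lower end of the interval excludes.\<close>

lemma primes_in_interval:
  assumes "1 \<le> n" "n \<le> 2 ^ s"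
  shows "n \<le> s * (card {p. prime p \<and> m < p \<and> p \<le> n} + m) + 1"
proof -
  let ?P = "{p. prime p \<and> p \<le> n}" and ?I = "{p. prime p \<and> m < p \<and> p \<le> n}"
  have "card ?P \<le> card (?I \<union> {1..m})"
    by (intro card_mono) (auto simp: Suc_le_eq prime_gt_0_nat)
  also have "\<dots> \<le> card ?I + m" using card_Un_le[of ?I "{1..m}"] by simp
  finally have P: "card ?P \<le> card ?I + m" .
  have "2 ^ (n - 1) \<le> n ^ card ?P" using assms(1) by (rule chebyshev_lower)
  also have "\<dots> \<le> (2 ^ s) ^ card ?P" using assms(2) by (rule power_mono) simp
  finally have "(2::nat) ^ (n - 1) \<le> 2 ^ (s * card ?P)" by (simp add: power_mult)
  then have "n - 1 \<le> s * card ?P" by (rule power_le_imp_le_exp[rotated]) simp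
  also have "\<dots> \<le> s * (card ?I + m)" using P by (rule mult_le_mono2)
  finally show ?thesis by simp
qed

lemma two_mult_power_le: "2 * k ^ k \<le> (k + 1) ^ k" if "k \<ge> 1" for k :: nat
proof -
  have "2 * real k ^ k = real k ^ k * 2" by simp
  also have "\<dots> \<le> real k ^ k * (1 + 1 / real k) ^ k"
  proof (rule mult_left_mono)
    have "- 1 \<le> 1 / real k" using order_trans[of "- 1" 0 "1 / real k"] by simp
    then show "2 \<le> (1 + 1 / real k) ^ k" using Bernoulli_inequality[of "1 / real k" k] that by simp
  qed simp
  also have "\<dots> = (real k * (1 + 1 / real k)) ^ k" by (simp add: power_mult_distrib)
  also have "real k * (1 + 1 / real k) = real k + 1" using that by (simp add: field_simps)
  finally have "real (2 * k ^ k) \<le> real ((k + 1) ^ k)" by (simp add: add.commute)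
  then show ?thesis by (simp only: of_nat_le_iff)
qed

text \<open>Here \<open>l\<close> is the binary logarithm of the bound \<open>4 ^ w\<close> for \<open>y\<close>, and \<open>g\<close> an upper bound for that of \<open>l\<close>. The primes in \<open>G\<close> lie
between \<open>l\<close> and \<open>l * g\<^sup>2\<close>, the numbers \<open>n\<close> are the primes between \<open>l\<^sup>2 * g ^ 5\<close> and \<open>l\<^sup>2 * g ^ 7\<close>. The ratio
\<open>g\<^sup>2\<close> of the end points beats the density \<open>1 / g\<close> of the primes, so that both intervals contain enough of them;
the exponent 5 is what the condition \<open>32 * T \<le> L0 * N0\<close> on the costs asks for.\<close>

lemma fractions_in_upper_half_explicit:
  fixes w g y r :: nat
  defines "l \<equiv> 2 * w"
  assumes w: "1 \<le> w" and g: "256 \<le> g" "l \<le> 2 ^ g" and size: "l\<^sup>2 * g ^ 7 \<le> 2 ^ w"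
    and y: "y \<le> 4 ^ w"
    and r: "modulus (w + 3) y \<le> 2 * r" "r < 2 * modulus (w + 3) y"
  shows "\<exists>S. S \<subseteq> {m. m dvd modulus (w + 3) y} \<and> (\<forall>m\<in>S. m \<le> 4 ^ w * (l ^ 3 * g ^ 9)) \<and>
      (\<Sum>m\<in>S. 1 / real m) = real r / real (modulus (w + 3) y)"
proof -
  define L where "L = l * g\<^sup>2"
  define N0 where "N0 = l\<^sup>2 * g ^ 5"
  define N where "N = l\<^sup>2 * g ^ 7"
  define G where "G = {p. prime p \<and> l < p \<and> p \<le> L}"
  define I where "I = {p. prime p \<and> N0 < p \<and> p \<le> N}"
  define T where "T = 4 * card G * L * (l + 1)"
  have l: "2 \<le> l" using w by (simp add: l_def)
  have g2: "g \<le> 2 ^ g" by (simp add: less_imp_le_nat)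
  have fin: "finite G" "finite I" by (auto simp: G_def I_def)
  have Lpow: "L \<le> 2 ^ (3 * g)"
  proof -
    have "L \<le> 2 ^ g * (2 ^ g)\<^sup>2" unfolding L_def using g g2 by (intro mult_le_mono power_mono) auto
    also have "\<dots> = 2 ^ (3 * g)" by (simp flip: power_add power_mult)
    finally show ?thesis .
  qed
  have Npow: "N \<le> 2 ^ (9 * g)"
  proof -
    have "N \<le> (2 ^ g)\<^sup>2 * (2 ^ g) ^ 7" unfolding N_def using g g2 by (intro mult_le_mono power_mono) auto
    also have "\<dots> = 2 ^ (9 * g)" by (simp flip: power_add power_mult)
    finally show ?thesis .
  qed
  have cardG: "2 * l \<le> card G"
  proof (rule ccontr)
    assume neg: "\<not> ?thesis"
    have "L \<le> 3 * g * (card G + l) + 1"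
      unfolding G_def using Lpow l g by (intro primes_in_interval) (auto simp: L_def)
    also have "\<dots> \<le> 3 * g * (2 * l + l) + 1" using neg by (intro add_mono mult_le_mono) auto
    finally have "l * g\<^sup>2 \<le> 9 * (l * g) + 1" by (simp add: L_def algebra_simps)
    moreover have "256 * (l * g) \<le> l * g\<^sup>2" using g by (simp add: power2_eq_square)
    moreover have "1 \<le> l * g" using l g by (simp add: Suc_le_eq)
    ultimately show False by linarith
  qed
  have cardI: "32 * (l\<^sup>2 * g\<^sup>2) \<le> card I"
  proof (rule ccontr)
    assume neg: "\<not> ?thesis"
    have N1: "1 \<le> N" using l g by (simp add: N_def Suc_le_eq)
    have "N \<le> 9 * g * (card I + N0) + 1"
      unfolding I_def using Npow N1 by (intro primes_in_interval) auto
    also have "\<dots> \<le> 9 * g * (32 * (l\<^sup>2 * g\<^sup>2) + N0) + 1" using neg by (intro add_mono mult_le_mono) auto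
    finally have "l\<^sup>2 * g ^ 7 \<le> 288 * (l\<^sup>2 * g ^ 3) + 9 * (l\<^sup>2 * g ^ 6) + 1"
      by (simp add: N_def N0_def algebra_simps eval_nat_numeral)
    moreover have "256 * (l\<^sup>2 * g ^ 6) \<le> l\<^sup>2 * g ^ 7"
      using mult_le_mono1[OF g(1), of "l\<^sup>2 * g ^ 6"] by (simp add: algebra_simps eval_nat_numeral)
    moreover have "l\<^sup>2 * g ^ 3 * 256 \<le> l\<^sup>2 * g ^ 6"
    proof -
      have "256 * 1 \<le> g * g\<^sup>2" using g by (intro mult_le_mono) auto
      then have "l\<^sup>2 * g ^ 3 * 256 \<le> l\<^sup>2 * g ^ 3 * (g * g\<^sup>2)" by (intro mult_le_mono2) simp
      also have "\<dots> = l\<^sup>2 * g ^ 6" by (simp add: eval_nat_numeral)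
      finally show ?thesis .
    qed
    moreover have "1 \<le> l\<^sup>2 * g ^ 3" using l g by (simp add: Suc_le_eq)
    ultimately show False by linarith
  qed
  obtain N1 where N1: "N1 \<subseteq> I" "card N1 = 16 * (l\<^sup>2 * g\<^sup>2)" "finite N1"
    using obtain_subset_with_card_n[of "16 * (l\<^sup>2 * g\<^sup>2)" I] cardI by auto
  define N2 where "N2 = I - N1"
  have cardN: "16 * (l\<^sup>2 * g\<^sup>2) \<le> card N1" "16 * (l\<^sup>2 * g\<^sup>2) \<le> card N2"
    using N1 cardI by (auto simp: N2_def card_Diff_subset)
  have T_le: "2 * T \<le> card G * k" if "16 * (l\<^sup>2 * g\<^sup>2) \<le> k" for k
  proof -
    have "8 * L * (l + 1) \<le> 8 * L * (2 * l)" using l by (intro mult_le_mono2) simp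
    also have "\<dots> = 16 * (l\<^sup>2 * g\<^sup>2)" by (simp add: L_def power2_eq_square)
    finally have "card G * (8 * L * (l + 1)) \<le> card G * k" using that by (intro mult_le_mono2) simp
    then show ?thesis by (simp add: T_def algebra_simps)
  qed
  have cardG_le: "card G \<le> L"
  proof -
    have "G \<subseteq> {1..L}" using l by (auto simp: G_def)
    then have "card G \<le> card {1..L}" by (intro card_mono) auto
    then show ?thesis by simp
  qed
  have order: "L \<le> N0"
  proof -
    have "l * g\<^sup>2 \<le> l\<^sup>2 * g ^ 5" using l g by (intro mult_le_mono power_increasing) (auto simp: power2_eq_square)
    then show ?thesis by (simp add: L_def N0_def)
  qed
  have zsq: "((2::nat) ^ w)\<^sup>2 = 4 ^ w"
    by (metis mult.commute power2_eq_square power_mult power_mult_distrib num_double numeral_times_numeral)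
  show ?thesis
  proof (rule fractions_in_upper_half[where z = "2 ^ w" and G = G and ?N1.0 = N1 and ?N2.0 = N2 and
        L = L and ?L0.0 = l and N = N and ?N0.0 = N0 and T = T])
    show "(2::nat) \<le> 2 ^ w" using w by (metis power_increasing power_one_right one_le_numeral)
    show "2 ^ (w + 3) = 8 * (2 ^ w :: nat)" by (simp add: power_add)
    show "y \<le> (2 ^ w)\<^sup>2" using y by (simp only: zsq)
    show "32 * T \<le> l * N0"
    proof -
      have "32 * T = 128 * (card G * L * (l + 1))" by (simp add: T_def)
      also have "\<dots> \<le> 128 * (L * L * (2 * l))" using cardG_le l by (intro mult_le_mono2 mult_le_mono) auto
      also have "\<dots> = 256 * (l ^ 3 * g ^ 4)"
        by (simp only: L_def power2_eq_square power3_eq_cube power4_eq_xxxx) simp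
      also have "\<dots> \<le> g * (l ^ 3 * g ^ 4)" using g by (intro mult_le_mono1)
      also have "\<dots> = l * N0" by (simp add: N0_def eval_nat_numeral)
      finally show ?thesis .
    qed
    show "(2 ^ w)\<^sup>2 \<le> \<Prod>H" if H: "H \<subseteq> G" "card G \<le> 2 * card H" for H
    proof -
      have "(2::nat) ^ (2 * w) \<le> 2 ^ card H"
        using H cardG by (intro power_increasing) (auto simp: l_def)
      also have "\<dots> = (\<Prod>q\<in>H. 2)" by simp
      also have "\<dots> \<le> \<Prod>H" using H l by (intro prod_mono) (auto simp: G_def)
      finally show ?thesis by (simp add: power_mult[symmetric] mult.commute)
    qed
    \<comment> \<open>Every block of \<open>\<kappa>\<close> steps doubles the set of subset sums, and \<open>T\<close> consists of \<open>l + 1\<close> blocks.\<close>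
    define \<kappa> where "\<kappa> = 4 * card G * L"
    have \<kappa>: "\<kappa> \<ge> 1" using cardG l g by (simp add: \<kappa>_def L_def Suc_le_eq)
    have "(2 ^ w)\<^sup>2 * \<kappa> ^ T < 2 ^ (l + 1) * \<kappa> ^ T"
      using \<kappa> by (simp add: l_def power_mult[symmetric] mult.commute)
    also have "\<dots> = (2 * \<kappa> ^ \<kappa>) ^ (l + 1)"
    proof -
      have "T = \<kappa> * (l + 1)" by (simp add: T_def \<kappa>_def)
      then show ?thesis by (simp only: power_mult power_mult_distrib)
    qed
    also have "\<dots> \<le> ((\<kappa> + 1) ^ \<kappa>) ^ (l + 1)" using two_mult_power_le[OF \<kappa>] by (rule power_mono) simp
    also have "\<dots> = (\<kappa> + 1) ^ T" by (simp only: T_def \<kappa>_def power_mult)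
    finally show "(2 ^ w)\<^sup>2 * (4 * card G * L) ^ T < (4 * card G * L + 1) ^ T" by (simp only: \<kappa>_def)
    show "(2 ^ w)\<^sup>2 * (L * N) \<le> 4 ^ w * (l ^ 3 * g ^ 9)"
    proof -
      have "g ^ 9 = g\<^sup>2 * g ^ 7" by (simp flip: power_add)
      then have "L * N = l ^ 3 * g ^ 9" by (simp add: L_def N_def power2_eq_square power3_eq_cube)
      then show ?thesis by (simp add: zsq)
    qed
    show "8 * (2 ^ w)\<^sup>2 \<le> 4 ^ w * (l ^ 3 * g ^ 9)"
    proof -
      have "1 * g ^ 1 \<le> l ^ 3 * g ^ 9" using l g by (intro mult_le_mono power_increasing) auto
      then have "8 \<le> l ^ 3 * g ^ 9" using g by simp
      then show ?thesis by (simp add: zsq)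
    qed
    show "2 \<le> N0"
    proof -
      have "2 * 1 \<le> l * g\<^sup>2" using l g by (intro mult_le_mono) auto
      then show ?thesis using order by (simp add: L_def)
    qed
    show "N \<le> 2 ^ w" using size by (simp only: N_def)
    show "prime q \<and> l < q \<and> q \<le> L" if "q \<in> G" for q using that by (simp add: G_def)
    show "prime n \<and> N0 < n \<and> n \<le> N" if "n \<in> N1 \<union> N2" for n
      using that N1(1) by (auto simp: N2_def I_def)
    show "finite N2" "N1 \<inter> N2 = {}" using fin by (auto simp: N2_def)
    show "finite G" "finite N1" by (fact fin N1(3))+
    show "2 \<le> l" "L \<le> N0" by (fact l order)+
    show "2 * T \<le> card G * card N1" "2 * T \<le> card G * card N2" using cardN by (simp_all only: T_le)
    show "modulus (w + 3) y \<le> 2 * r" "r < 2 * modulus (w + 3) y" by (fact r)+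
  qed
qed

text \<open>The primes between \<open>2 ^ w\<close> and \<open>4 ^ w\<close> alone suffice: each contributes a factor \<open>2 ^ w\<close>, the square root of the upper
end, so that only a factor 2 in the exponent is lost.\<close>

lemma modulus_lower_bound:
  assumes w: "1 \<le> w" and big: "4 * w * 2 ^ w + 2 \<le> 4 ^ w"
  shows "2 ^ (4 ^ (w - 1)) \<le> modulus t (4 ^ w)"
proof -
  define I where "I = {p. prime p \<and> (2::nat) ^ w < p \<and> p \<le> 4 ^ w}"
  have "(4::nat) ^ w \<le> 2 * w * (card I + 2 ^ w) + 1"
    unfolding I_def by (intro primes_in_interval) (auto simp: power_mult)
  then have "4 ^ w \<le> 4 * (w * card I)" using big by (simp add: algebra_simps)
  then have "4 ^ (w - 1) \<le> w * card I" using w by (cases w) auto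
  then have "(2::nat) ^ (4 ^ (w - 1)) \<le> 2 ^ (w * card I)" by (rule power_increasing) simp
  also have "\<dots> = (\<Prod>p\<in>I. 2 ^ w)" by (simp add: power_mult)
  also have "\<dots> \<le> \<Prod>I" by (intro prod_mono) (auto simp: I_def)
  also have "\<dots> \<le> \<Prod>{p. prime p \<and> 2 < p \<and> p \<le> 4 ^ w}"
  proof (rule dvd_imp_le)
    have "(2::nat) \<le> 2 ^ w" using w by (metis power_increasing power_one_right one_le_numeral)
    then show "\<Prod>I dvd \<Prod>{p. prime p \<and> 2 < p \<and> p \<le> 4 ^ w}"
      by (intro prod_dvd_prod_subset) (auto simp: I_def)
  qed (auto intro!: prod_pos)
  also have "\<dots> \<le> modulus t (4 ^ w)" by (simp add: modulus_def)
  finally show ?thesis .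
qed

text \<open>The least \<open>y\<close> whose modulus reaches \<open>2 * b\<close> is at most \<open>4 ^ w\<close>, and by minimality the modulus then exceeds
\<open>2 * b\<close> by at most the factor \<open>y\<close>. The hypothesis \<open>2 ^ (w + 2) < b\<close> excludes that the power of 2 alone reaches it.\<close>

lemma denominators_bounded:
  fixes a b w g :: nat
  defines "l \<equiv> 2 * w"
  assumes ab: "1 \<le> a" "a < b" and w: "1 \<le> w" and g: "256 \<le> g" "l \<le> 2 ^ g"
    and size: "l\<^sup>2 * g ^ 7 \<le> 2 ^ w" and b: "b \<le> 2 ^ (4 ^ (w - 1))" "2 ^ (w + 2) < b"
  shows "\<exists>S. S \<subseteq> {2..b * (4 ^ w * (l ^ 3 * g ^ 9))} \<and> (\<Sum>m\<in>S. 1 / real m) = real a / real b"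
proof -
  define M where "M = 4 ^ w * (l ^ 3 * g ^ 9)"
  have l: "l \<ge> 2" using w by (simp add: l_def)
  have M2: "2 * 4 ^ w \<le> M"
  proof -
    have "1 * g ^ 1 \<le> l ^ 3 * g ^ 9" using l g by (intro mult_le_mono power_increasing) auto
    then have "2 \<le> l ^ 3 * g ^ 9" using g by simp
    then show ?thesis by (simp add: M_def)
  qed
  have "4 * w * 2 ^ w + 2 \<le> 4 ^ w"
  proof -
    have "2 * w * 256 \<le> l\<^sup>2 * g ^ 7"
      using l g power_increasing[of 1 7 g] by (intro mult_le_mono) (auto simp: l_def power2_eq_square)
    then have "4 * w + 2 \<le> 2 ^ w" using size w by linarith
    then have "(4 * w + 2) * 2 ^ w \<le> 2 ^ w * 2 ^ w" by (rule mult_le_mono1)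
    also have "(2::nat) ^ w * 2 ^ w = 4 ^ w" by (simp flip: power_mult_distrib)
    finally have "4 * w * 2 ^ w + 2 * 2 ^ w \<le> (4::nat) ^ w" by (simp add: algebra_simps)
    moreover have "(1::nat) \<le> 2 ^ w" by simp
    ultimately show ?thesis by linarith
  qed
  then have low: "b \<le> modulus t (4 ^ w)" for t
    using modulus_lower_bound[OF w] b(1) le_trans by blast
  define y where "y = (LEAST y. 2 * b \<le> modulus (w + 3) y)"
  have "modulus (w + 3) (4 ^ w) = 2 ^ (w + 3) * modulus 0 (4 ^ w)" by (simp add: modulus_def)
  also have "\<dots> \<ge> 2 * b"  using low[of 0] by (intro mult_le_mono) (auto simp: power_add)
  finally have ex: "2 * b \<le> modulus (w + 3) (4 ^ w)" .
  then have y1: "2 * b \<le> modulus (w + 3) y" unfolding y_def by (rule LeastI)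
  have y4: "y \<le> 4 ^ w" unfolding y_def using ex by (rule Least_le)
  have "\<not> y \<le> 2" using y1 b(2) modulus_le_2[of y "w + 3"] by (auto simp: power_add)
  then obtain y' where y': "y = Suc y'" "2 \<le> y'" by (cases y) auto
  have "y' < (LEAST y. 2 * b \<le> modulus (w + 3) y)" using y'(1) by (simp flip: y_def)
  then have "\<not> 2 * b \<le> modulus (w + 3) y'" by (rule not_less_Least)
  then have "modulus (w + 3) y' < 2 * b" by simp
  moreover have "modulus (w + 3) y \<le> y * modulus (w + 3) y'"
    using modulus_prime[of y' "w + 3"] modulus_not_prime[of y' "w + 3"] y' by (cases "prime y") auto
  ultimately have "modulus (w + 3) y \<le> y * (2 * b)" by (meson le_trans less_imp_le_nat mult_le_mono2)
  also have "\<dots> \<le> 4 ^ w * (2 * b)" using y4 by (rule mult_le_mono1)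
  also have "\<dots> \<le> b * M" using M2 by (simp add: mult.left_commute mult.commute)
  finally have QM: "modulus (w + 3) y \<le> b * M" .
  show ?thesis unfolding M_def[symmetric]
  proof (rule unit_fractions_from_modulus[OF ab _ y1 QM])
    show "even (modulus (w + 3) y)" by (simp add: modulus_def)
    show "\<exists>S. S \<subseteq> {m. m dvd modulus (w + 3) y} \<and> (\<Sum>m\<in>S. 1 / real m) = real s / real (modulus (w + 3) y)"
      if "s < modulus (w + 3) y" for s
      using that by (intro modulus_unit_fractions) auto
    show "\<exists>S. S \<subseteq> {m. m dvd modulus (w + 3) y} \<and> (\<forall>m\<in>S. m \<le> M) \<and>
      (\<Sum>m\<in>S. 1 / real m) = real r / real (modulus (w + 3) y)"
      if "modulus (w + 3) y \<le> 2 * r" "r < modulus (w + 3) y" for r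
    proof -
      have "r < 2 * modulus (w + 3) y" using that by simp
      with w g size y4 that(1) show ?thesis
        unfolding l_def M_def by (rule fractions_in_upper_half_explicit)
    qed
  qed
qed

section \<open>Asymptotics and conclusion\<close>

lemma half_le_ln_2: "1 / 2 \<le> ln (2::real)"
  using ln_le_minus_one[of "1 / 2 :: real"] by (simp add: ln_div)

lemma one_le_ln_4: "1 \<le> ln (4::real)"
  using half_le_ln_2 ln_realpow[of 2 2] by simp

text \<open>The constant 40310784 is \<open>32 * 4 ^ 3 * 3 ^ 9\<close>, the product of the constants lost in the comparison of \<open>w\<close> and \<open>g\<close>
with iterated logarithms of \<open>b\<close>.\<close>

lemma large_parameters:
  "eventually (\<lambda>w::nat. 2 ^ 256 \<le> w \<and> (2 * real w)\<^sup>2 * (4 * real w) ^ 7 \<le> 2 ^ w \<and>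
    16 * (real w + 2) \<le> 4 ^ w \<and> real w / 2 \<le> (real w - 2) * ln 4 + ln (ln 2) \<and>
    40310784 \<le> ln (real w / 2)) sequentially"
proof (intro eventually_conj)
  show "eventually (\<lambda>w::nat. 2 ^ 256 \<le> w) sequentially" by (rule eventually_ge_at_top)
  show "eventually (\<lambda>w::nat. (2 * real w)\<^sup>2 * (4 * real w) ^ 7 \<le> 2 ^ w) sequentially" by real_asymp
  show "eventually (\<lambda>w::nat. 16 * (real w + 2) \<le> 4 ^ w) sequentially" by real_asymp
  have "filterlim (\<lambda>w::nat. real w / 2 - 2 + ln (ln 2)) at_top sequentially" by real_asymp
  then have "eventually (\<lambda>w::nat. 0 \<le> real w / 2 - 2 + ln (ln 2)) sequentially"
    unfolding filterlim_at_top by blast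
  then show "eventually (\<lambda>w::nat. real w / 2 \<le> (real w - 2) * ln 4 + ln (ln 2)) sequentially"
    using eventually_ge_at_top[of 2]
  proof eventually_elim
    case (elim w)
    define X where "X = (real w - 2) * ln 4"
    have "(real w - 2) * 1 \<le> X"
      unfolding X_def using elim one_le_ln_4 by (intro mult_left_mono) auto
    then have "real w / 2 \<le> X + ln (ln 2)" using elim(1) by simp
    then show ?case unfolding X_def .
  qed
  have "filterlim (\<lambda>w::nat. ln (real w / 2)) at_top sequentially" by real_asymp
  then show "eventually (\<lambda>w::nat. 40310784 \<le> ln (real w / 2)) sequentially"
    unfolding filterlim_at_top by blast
qed

text \<open>The choice of \<open>w\<close> gives \<open>4 ^ w \<le> 32 * ln b\<close> and \<open>2 * w \<le> 4 * ln (ln b)\<close>, that of \<open>g\<close> gives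
\<open>g \<le> 3 * ln (ln (ln b))\<close>. One more factor \<open>ln (ln (ln b))\<close>, raising the exponent from 9 to 10, absorbs the constants.\<close>

lemma denominator_bound_asymptotic:
  fixes b w g :: nat
  assumes b: "2 ^ (4 ^ (w - 2)) < b" and w: "2 \<le> w" and g: "2 ^ g < 4 * w"
    and ev: "real w / 2 \<le> (real w - 2) * ln 4 + ln (ln 2)" "40310784 \<le> ln (real w / 2)"
  shows "0 < ln (ln (ln b))"
    and "real (4 ^ w * ((2 * w) ^ 3 * g ^ 9)) \<le> ln b * ln (ln b) ^ 3 * ln (ln (ln b)) ^ 10"
proof -
  have "real (2 ^ (4 ^ (w - 2))) < real b" using b by (simp only: of_nat_less_iff)
  then have "(2::real) ^ (4 ^ (w - 2)) < b" by simp
  then have "ln ((2::real) ^ (4 ^ (w - 2))) \<le> ln b" by (subst ln_le_cancel_iff) auto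
  then have lnb: "4 ^ (w - 2) * ln 2 \<le> ln b" by (simp add: ln_realpow)
  have "real (4 ^ w) = 16 * 4 ^ (w - 2)"
  proof -
    have "(4::real) ^ w = 4 ^ (2 + (w - 2))" by (simp only: le_add_diff_inverse[OF w])
    then show ?thesis unfolding power_add by simp
  qed
  also have "\<dots> \<le> 32 * (4 ^ (w - 2) * ln 2)" using half_le_ln_2 by simp
  finally have w1: "real (4 ^ w) \<le> 32 * ln b" using lnb by linarith
  have pos: "0 < 4 ^ (w - 2) * ln (2::real)" by simp
  then have "ln (4 ^ (w - 2) * ln 2) \<le> ln (ln b)" using lnb by (subst ln_le_cancel_iff) linarith+
  moreover have "ln (4 ^ (w - 2) * ln 2) = (real w - 2) * ln 4 + ln (ln (2::real))"
    using w by (simp add: ln_mult ln_realpow of_nat_diff)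
  ultimately have w2: "real w / 2 \<le> ln (ln b)" using ev(1) by linarith
  have w0: "0 < real w" using w by simp
  then have w3: "ln (real w / 2) \<le> ln (ln (ln b))" using w2 by (subst ln_le_cancel_iff) linarith+
  have "real (2 ^ g) \<le> real (4 * w)" using g by (simp only: of_nat_le_iff)
  then have "ln ((2::real) ^ g) \<le> ln (4 * real w)" using w0 by (subst ln_le_cancel_iff) auto
  moreover have "ln 4 = 2 * ln (2::real)" using ln_realpow[of 2 2] by simp
  ultimately have "real g * ln 2 \<le> 2 * ln 2 + ln (real w)" using w0 by (simp add: ln_realpow ln_mult)
  moreover have "real g * (1 / 2) \<le> real g * ln 2" using half_le_ln_2 by (intro mult_left_mono) auto
  moreover have "ln (real w) = ln (real w / 2) + ln 2" using w0 by (simp add: ln_div)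
  ultimately have "real g * (1 / 2) \<le> 3 * ln 2 + ln (real w / 2)" by simp
  also have "3 * ln 2 \<le> (3::real)" using ln_le_minus_one[of "2::real"] by simp
  finally have "real g \<le> 6 + 2 * ln (real w / 2)" by simp
  also have "\<dots> \<le> 3 * ln (real w / 2)" using ev(2) by simp
  finally have "real g \<le> 3 * ln (real w / 2)" .
  then have g3: "real g \<le> 3 * ln (ln (ln b))" using w3 by linarith
  let ?c = "ln (ln (ln b))"
  have c: "40310784 \<le> ?c" using ev(2) w3 by linarith
  then show "0 < ?c" by linarith
  have "real (4 ^ w * ((2 * w) ^ 3 * g ^ 9)) = real (4 ^ w) * ((2 * real w) ^ 3 * real g ^ 9)" by simp
  also have "\<dots> \<le> (32 * ln b) * ((4 * ln (ln b)) ^ 3 * (3 * ?c) ^ 9)"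
  proof (rule mult_mono[OF w1])
    have "(2 * real w) ^ 3 \<le> (4 * ln (ln b)) ^ 3" using w2 w0 by (intro power_mono) linarith+
    moreover have "real g ^ 9 \<le> (3 * ?c) ^ 9" using g3 by (rule power_mono) simp
    ultimately show "(2 * real w) ^ 3 * real g ^ 9 \<le> (4 * ln (ln b)) ^ 3 * (3 * ?c) ^ 9"
      using w2 w0 by (intro mult_mono) simp_all
    show "0 \<le> 32 * ln (real b)" using lnb pos by linarith
  qed simp
  also have "\<dots> = ln b * ln (ln b) ^ 3 * (40310784 * ?c ^ 9)"
    by (simp add: power_mult_distrib)
  also have "\<dots> \<le> ln b * ln (ln b) ^ 3 * (?c * ?c ^ 9)"
    using c w0 w2 lnb pos by (intro mult_left_mono mult_right_mono mult_nonneg_nonneg zero_le_power) linarith+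
  also have "?c * ?c ^ 9 = ?c ^ 10" by (simp flip: power_Suc)
  finally show "real (4 ^ w * ((2 * w) ^ 3 * g ^ 9)) \<le> ln b * ln (ln b) ^ 3 * ?c ^ 10" .
qed

lemma bounded_egyptian_fractions:
  "\<exists>b0::nat. \<forall>a b. 1 \<le> a \<longrightarrow> a < b \<longrightarrow> b0 \<le> b \<longrightarrow> 0 < ln (ln (ln (real b))) \<and>
    (\<exists>S. finite S \<and> (\<forall>m\<in>S. 2 \<le> m \<and> real m \<le> real b * ln b * ln (ln b) ^ 3 * ln (ln (ln b)) ^ 10) \<and>
      (\<Sum>m\<in>S. 1 / real m) = real a / real b)"
proof -
  obtain w0 :: nat where w0: "\<And>w. w \<ge> w0 \<Longrightarrow> 2 ^ 256 \<le> w \<and> (2 * real w)\<^sup>2 * (4 * real w) ^ 7 \<le> 2 ^ w \<and>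
    16 * (real w + 2) \<le> 4 ^ w \<and> real w / 2 \<le> (real w - 2) * ln 4 + ln (ln 2) \<and> 40310784 \<le> ln (real w / 2)"
    using large_parameters unfolding eventually_sequentially by blast
  show ?thesis
  proof (intro exI[of _ "2 ^ (4 ^ w0) + 1"] allI impI)
    fix a b :: nat
    assume ab: "1 \<le> a" "a < b" and b0: "2 ^ (4 ^ w0) + 1 \<le> b"
    \<comment> \<open>With \<open>w = v + 1\<close> the number \<open>4 ^ w\<close> is between 4 and 16 times the binary logarithm of \<open>b\<close>.\<close>
    define v where "v = (LEAST v. b \<le> 2 ^ (4 ^ v))"
    have "b \<le> 2 ^ b" by (simp add: less_imp_le_nat)
    also have "(2::nat) ^ b \<le> 2 ^ (4 ^ b)"
    proof -
      have "b \<le> 2 ^ b" by (simp add: less_imp_le_nat)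
      also have "(2::nat) ^ b \<le> 4 ^ b" by (rule power_mono) auto
      finally show ?thesis by (rule power_increasing) simp
    qed
    finally have bv: "b \<le> 2 ^ (4 ^ v)" unfolding v_def by (rule LeastI)
    have vw0: "w0 < v"
    proof (rule ccontr)
      assume "\<not> w0 < v"
      then have "(2::nat) ^ (4 ^ v) \<le> 2 ^ (4 ^ w0)" by (intro power_increasing) auto
      then show False using bv b0 by linarith
    qed
    then have "\<not> b \<le> 2 ^ (4 ^ (v - 1))" unfolding v_def by (intro not_less_Least) (simp add: v_def)
    then have bv': "2 ^ (4 ^ (v - 1)) < b" by simp
    define w where "w = v + 1"
    have W: "2 ^ 256 \<le> w" "(2 * real w)\<^sup>2 * (4 * real w) ^ 7 \<le> 2 ^ w"
      "16 * (real w + 2) \<le> 4 ^ w" "real w / 2 \<le> (real w - 2) * ln 4 + ln (ln 2)" "40310784 \<le> ln (real w / 2)"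
      using w0[of w] vw0 by (auto simp: w_def)
    have w2: "2 \<le> w" using vw0 by (simp add: w_def)
    have bw: "b \<le> 2 ^ (4 ^ (w - 1))" "2 ^ (4 ^ (w - 2)) < b"
      using bv bv' by (simp_all add: w_def)
    define g where "g = (LEAST g. 2 * w \<le> 2 ^ g)"
    have g1: "2 * w \<le> 2 ^ g" unfolding g_def
      by (rule LeastI[of _ "2 * w"]) (simp add: less_imp_le_nat)
    have "(2::nat) ^ 256 \<le> 2 ^ g" using W(1) g1 by linarith
    then have g2: "256 \<le> g" by (rule power_le_imp_le_exp[rotated]) simp
    then have "\<not> 2 * w \<le> 2 ^ (g - 1)" unfolding g_def by (intro not_less_Least) (simp add: g_def)
    moreover have "(2::nat) ^ g = 2 * 2 ^ (g - 1)" using g2 by (cases g) auto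
    ultimately have g3: "2 ^ g < 4 * w" by linarith
    have "g < 2 ^ g" by simp
    then have "g \<le> 4 * w" using g3 by linarith
    then have "(2 * w)\<^sup>2 * g ^ 7 \<le> (2 * w)\<^sup>2 * (4 * w) ^ 7" by (intro mult_le_mono2 power_mono) auto
    also have "\<dots> \<le> 2 ^ w"
    proof -
      have "real ((2 * w)\<^sup>2 * (4 * w) ^ 7) \<le> real (2 ^ w)" using W(2) by simp
      then show ?thesis by (simp only: of_nat_le_iff)
    qed
    finally have size: "(2 * w)\<^sup>2 * g ^ 7 \<le> 2 ^ w" .
    have "2 ^ (w + 2) < b"
    proof -
      have "real (16 * (w + 2)) \<le> real (4 ^ w)" using W(3) by simp
      then have "16 * (w + 2) \<le> 4 ^ w" by (simp only: of_nat_le_iff)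
      also have "(4::nat) ^ w = 16 * 4 ^ (w - 2)"
      proof -
        have "(4::nat) ^ w = 4 ^ (2 + (w - 2))" by (simp only: le_add_diff_inverse[OF w2])
        then show ?thesis unfolding power_add by simp
      qed
      finally have "w + 2 \<le> 4 ^ (w - 2)" by simp
      then have "(2::nat) ^ (w + 2) \<le> 2 ^ (4 ^ (w - 2))" by (rule power_increasing) simp
      then show ?thesis using bw(2) by linarith
    qed
    then obtain S where S: "S \<subseteq> {2..b * (4 ^ w * ((2 * w) ^ 3 * g ^ 9))}"
      "(\<Sum>m\<in>S. 1 / real m) = real a / real b"
      using denominators_bounded[OF ab _ g2 g1 size bw(1)] w2 by auto
    have M: "real (4 ^ w * ((2 * w) ^ 3 * g ^ 9)) \<le> ln b * ln (ln b) ^ 3 * ln (ln (ln b)) ^ 10"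
      using bw(2) w2 g3 W(4,5) by (rule denominator_bound_asymptotic(2))
    have "real m \<le> real b * ln b * ln (ln b) ^ 3 * ln (ln (ln b)) ^ 10" if "m \<in> S" for m
    proof -
      have "m \<le> b * (4 ^ w * ((2 * w) ^ 3 * g ^ 9))" using S(1) that by auto
      then have "real m \<le> real (b * (4 ^ w * ((2 * w) ^ 3 * g ^ 9)))" by (simp only: of_nat_le_iff)
      also have "\<dots> = real b * real (4 ^ w * ((2 * w) ^ 3 * g ^ 9))" by (simp only: of_nat_mult)
      also have "\<dots> \<le> real b * (ln b * ln (ln b) ^ 3 * ln (ln (ln b)) ^ 10)"
        using M by (intro mult_left_mono) auto
      finally show ?thesis by (simp only: mult.assoc)
    qed
    moreover have "0 < ln (ln (ln (real b)))"
      using bw(2) w2 g3 W(4,5) by (rule denominator_bound_asymptotic(1))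
    moreover have "finite S" using S(1) by (rule finite_subset) simp
    ultimately show "0 < ln (ln (ln (real b))) \<and>
      (\<exists>S. finite S \<and> (\<forall>m\<in>S. 2 \<le> m \<and> real m \<le> real b * ln b * ln (ln b) ^ 3 * ln (ln (ln b)) ^ 10) \<and>
      (\<Sum>m\<in>S. 1 / real m) = real a / real b)"
      using S by (intro conjI exI[of _ S]) auto
  qed
qed

theorem theorem1p5:
  shows "\<exists>(C::real) (b0::real). C > 0 \<and>
    (\<forall>(a::int) (b::int). 1 \<le> a \<and> a < b \<and> real_of_int b \<ge> b0 \<longrightarrow>
      (\<exists>(k::nat) (n::nat \<Rightarrow> int).
        k \<ge> 1 \<and>
        1 < n 1 \<and>
        strict_mono_on {1..k} n \<and>
        real_of_int (n k) \<le> real_of_int b * ln (real_of_int b) *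
            ln (ln (real_of_int b)) ^ 3 *
            ln (ln (ln (real_of_int b))) powr C \<and>
        real_of_int a / real_of_int b = (\<Sum>i=1..k. 1 / real_of_int (n i))))"
proof -
  obtain b0 :: nat where b0: "\<And>a b. 1 \<le> a \<Longrightarrow> a < b \<Longrightarrow> b0 \<le> b \<Longrightarrow> 0 < ln (ln (ln (real b))) \<and>
    (\<exists>S. finite S \<and> (\<forall>m\<in>S. 2 \<le> m \<and> real m \<le> real b * ln b * ln (ln b) ^ 3 * ln (ln (ln b)) ^ 10) \<and>
      (\<Sum>m\<in>S. 1 / real m) = real a / real b)"
    using bounded_egyptian_fractions by blast
  show ?thesis
  proof (rule exI[of _ 10], rule exI[of _ "real b0"], intro conjI allI impI)
    fix a b :: int
    assume ab: "1 \<le> a \<and> a < b \<and> real_of_int b \<ge> real b0"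
    have nat: "real (nat a) = real_of_int a" "real (nat b) = real_of_int b" using ab by simp_all
    have "1 \<le> nat a" "nat a < nat b" "b0 \<le> nat b" using ab by linarith+
    from b0[OF this] obtain S where c: "0 < ln (ln (ln (real_of_int b)))" and S: "finite S"
      "\<And>m. m \<in> S \<Longrightarrow> 2 \<le> m \<and> real m \<le> real_of_int b * ln (real_of_int b) * ln (ln (real_of_int b)) ^ 3
        * ln (ln (ln (real_of_int b))) ^ 10"
      "(\<Sum>m\<in>S. 1 / real m) = real_of_int a / real_of_int b" unfolding nat by blast
    define xs where "xs = sorted_list_of_set S"
    define n where "n i = int (xs ! (i - 1))" for i
    have xs: "set xs = S" "sorted_wrt (<) xs" "distinct xs" "length xs = card S"
      using S(1) by (auto simp: xs_def)
    have "S \<noteq> {}"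
    proof
      assume "S = {}"
      then show False using S(3) ab by simp
    qed
    then have k: "card S \<ge> 1" using S(1) by (simp add: Suc_le_eq card_gt_0_iff)
    have mem: "xs ! (i - 1) \<in> S" if "i \<in> {1..card S}" for i
      unfolding xs(1)[symmetric] using that xs(4) by (intro nth_mem) auto
    have "strict_mono_on {1..card S} n"
    proof (rule strict_mono_onI)
      fix i j assume "i \<in> {1..card S}" "j \<in> {1..card S}" "i < j"
      then have "xs ! (i - 1) < xs ! (j - 1)"
        using xs by (intro sorted_wrt_nth_less[of "(<)"]) auto
      then show "n i < n j" by (simp add: n_def)
    qed
    moreover have "1 < n 1" using S(2)[OF mem[of 1]] k by (simp add: n_def)
    moreover have "real_of_int (n (card S)) \<le> real_of_int b * ln (real_of_int b) *
        ln (ln (real_of_int b)) ^ 3 * ln (ln (ln (real_of_int b))) powr 10"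
      using S(2)[OF mem[of "card S"]] k powr_realpow[OF c, of 10] by (simp add: n_def)
    moreover have "real_of_int a / real_of_int b = (\<Sum>i=1..card S. 1 / real_of_int (n i))"
    proof -
      have "bij_betw (\<lambda>i. xs ! (i - 1)) {1..card S} S"
      proof -
        have "bij_betw ((!) xs) {..<card S} S"
          by (rule bij_betw_nth[OF xs(3)]) (simp_all only: xs(1,4))
        moreover have "bij_betw (\<lambda>i. i - 1) {1..card S} {..<card S}"
          by (rule bij_betw_byWitness[where f' = Suc]) auto
        ultimately have "bij_betw ((!) xs \<circ> (\<lambda>i. i - 1)) {1..card S} S"
          by (rule bij_betw_trans[rotated])
        then show ?thesis by (simp add: o_def)
      qed
      then have "(\<Sum>i=1..card S. 1 / real (xs ! (i - 1))) = (\<Sum>m\<in>S. 1 / real m)"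
        by (rule sum.reindex_bij_betw)
      then show ?thesis using S(3) by (simp add: n_def)
    qed
    ultimately show "\<exists>(k::nat) (n::nat \<Rightarrow> int). k \<ge> 1 \<and> 1 < n 1 \<and> strict_mono_on {1..k} n \<and>
        real_of_int (n k) \<le> real_of_int b * ln (real_of_int b) *
            ln (ln (real_of_int b)) ^ 3 * ln (ln (ln (real_of_int b))) powr 10 \<and>
        real_of_int a / real_of_int b = (\<Sum>i=1..k. 1 / real_of_int (n i))"
      using k by blast
  qed simp
qed

end
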